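(* Suppose that, for some $r\in\mathbb{N}$ and $n\in\mathbb{N}$, $\Delta_t^{(r)}/\Delta_t^{(r+n)}\xrightarrow{\mathrm{D}}Y$ as $t\downarrow0$, for an extended-value random variable $Y\ge1$ (that is, $Y$ takes values in $[1,\infty]$ and may take the value $+\infty$ with positive probability). Then one of the following holds: (i) $\mathrm{P}(1<Y<\infty)>0$, in which case $\overline{\Pi}$ is regularly varying at $0$ with index $-\alpha$ for some $0<\alpha<\infty$; (ii) $\mathrm{P}(Y=1)=1$, in which case $\overline{\Pi}$ is rapidly varying at $0$; (iii) $Y=\infty$ almost surely, in which case $\overline{\Pi}$ is slowly varying at $0$.
   Context: $\mathbb{N}=\{1,2,\dots\}$. $\Pi$ is a Borel measure on $(0,\infty)$, locally finite at infinity, with tail function $\overline{\Pi}(x)=\Pi\{(x,\infty)\}$, $x>0$, taking values in $(0,\infty)$, and $\overline{\Pi}(0+)=\Pi\{(0,\infty)\}=\infty$. For each $t>0$, $\Delta_t^{(1)}\ge\Delta_t^{(2)}\ge\cdots>0$ are the points, listed in decreasing order with possible ties, of a Poisson point process on $(0,\infty)$ with intensity measure $t\,\Pi(\mathrm{d}x)$. $\overline{\Pi}$ is regularly varying at $0$ with index $-\alpha$ if $\lim_{x\downarrow0}\overline{\Pi}(\lambda x)/\overline{\Pi}(x)=\lambda^{-\alpha}$ for all $\lambda>0$; slowly varying at $0$ means this with $\alpha=0$; rapidly varying at $0$ means this with $\alpha=\infty$, where $\lambda^{-\infty}$ is interpreted as $0$ for $\lambda>1$, $1$ for $\lambda=1$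 and $+\infty$ for $\lambda<1$. $\xrightarrow{\mathrm{D}}$ denotes convergence in distribution (here on $[1,\infty]$). *)

theory Defs
  imports "HOL-Probability.Probability"
begin

definition num_points :: "(nat \<Rightarrow> real) \<Rightarrow> real set \<Rightarrow> enat" where
  \<comment> \<open>points are indexed from 1, as in the notation of order statistics; ties are counted
      with multiplicity and the value at index 0 is ignored\<close>
  "num_points x B =
     (if finite {i. 1 \<le> i \<and> x i \<in> B} then enat (card {i. 1 \<le> i \<and> x i \<in> B}) else \<infinity>)"

text \<open>The constant \<open>poisson_pmf\<close> does not cover the parameters 0 and infinity, which are
  needed here; the Poisson law with infinite parameter is the point mass at infinity, and the
  one with parameter 0 is the point mass at 0 (note \<open>0 ^ 0 = 1\<close>).\<close>

definition poisson_distributed :: "'a measure \<Rightarrow> ('a \<Rightarrow> enat) \<Rightarrow> ennreal \<Rightarrow> bool" where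
  "poisson_distributed M Z l \<longleftrightarrow>
     Z \<in> measurable M (count_space UNIV) \<and>
     (if l = \<infinity> then (AE \<omega> in M. Z \<omega> = \<infinity>)
      else (\<forall>k. measure M {\<omega> \<in> space M. Z \<omega> = enat k} =
                 exp (- enn2real l) * enn2real l ^ k / fact k))"

definition poisson_random_measure ::
    "'a measure \<Rightarrow> (real set \<Rightarrow> 'a \<Rightarrow> enat) \<Rightarrow> real measure \<Rightarrow> bool" where
  "poisson_random_measure M Z \<mu> \<longleftrightarrow>
     (\<forall>B\<in>sets \<mu>. poisson_distributed M (Z B) (emeasure \<mu> B)) \<and>
     (\<forall>A :: nat \<Rightarrow> real set. range A \<subseteq> sets \<mu> \<longrightarrow> disjoint_family A \<longrightarrow>
        prob_space.indep_vars M (\<lambda>_. count_space UNIV) (\<lambda>j. Z (A j)) UNIV)"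

definition ordered_ppp :: "'a measure \<Rightarrow> (nat \<Rightarrow> 'a \<Rightarrow> real) \<Rightarrow> real measure \<Rightarrow> bool" where
  "ordered_ppp M X \<mu> \<longleftrightarrow>
     (\<forall>i\<ge>1. X i \<in> borel_measurable M) \<and>
     (AE \<omega> in M. \<forall>i\<ge>1. X i \<omega> \<ge> X (Suc i) \<omega> \<and> X (Suc i) \<omega> > 0) \<and>
     poisson_random_measure M (\<lambda>B \<omega>. num_points (\<lambda>i. X i \<omega>) B) \<mu>"

text \<open>Convergence in distribution of random elements that almost surely take values in \<open>S\<close>.
  The test functions are the bounded continuous functions on \<open>S\<close>; they are represented by Borel
  functions on the whole type so that the integrals do not depend on the null event that a value
  lies outside \<open>S\<close>.\<close>

definition converges_in_distribution_on ::
    "'b::topological_space set \<Rightarrow> ('t \<Rightarrow> 'a measure) \<Rightarrow> ('t \<Rightarrow> 'a \<Rightarrow> 'b) \<Rightarrow>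
     'c measure \<Rightarrow> ('c \<Rightarrow> 'b) \<Rightarrow> 't filter \<Rightarrow> bool" where
  "converges_in_distribution_on S M X N Y F \<longleftrightarrow>
     (\<forall>f :: 'b \<Rightarrow> real. f \<in> borel_measurable borel \<longrightarrow> continuous_on S f \<longrightarrow> bounded (f ` S) \<longrightarrow>
        ((\<lambda>t. \<integral>\<omega>. f (X t \<omega>) \<partial>M t) \<longlongrightarrow> (\<integral>\<omega>. f (Y \<omega>) \<partial>N)) F)"

definition tail :: "real measure \<Rightarrow> real \<Rightarrow> real" where
  "tail \<nu> x = measure \<nu> {x<..}"

definition regularly_varying_at_0 :: "(real \<Rightarrow> real) \<Rightarrow> real \<Rightarrow> bool" where
  \<comment> \<open>the second argument is the index\<close>
  "regularly_varying_at_0 f \<rho> \<longleftrightarrow>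
     (\<forall>l>0. ((\<lambda>x. f (l * x) / f x) \<longlongrightarrow> l powr \<rho>) (at_right 0))"

definition slowly_varying_at_0 :: "(real \<Rightarrow> real) \<Rightarrow> bool" where
  "slowly_varying_at_0 f \<longleftrightarrow> regularly_varying_at_0 f 0"

definition rapidly_varying_at_0 :: "(real \<Rightarrow> real) \<Rightarrow> bool" where
  \<comment> \<open>index \<open>-\<infinity>\<close>\<close>
  "rapidly_varying_at_0 f \<longleftrightarrow>
     (\<forall>l>0. ((\<lambda>x. ereal (f (l * x) / f x)) \<longlongrightarrow>
        (if l > 1 then 0 else if l = 1 then 1 else \<infinity>)) (at_right 0))"

end

theory Submission imports Defs begin

text \<open>Write \<open>T\<close> for the tail of \<open>\<nu>\<close>, \<open>T\<^sup>-\<close> for its generalised inverse and \<open>k = r + n - 1\<close>.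
  The theorem rests on three ideas.

  \<^item> \<^emph>\<open>An explicit law.\<close> If \<open>\<nu>\<close> has no atoms then, given the point of rank \<open>k + 1\<close>, the \<open>k\<close>
    larger points are independent draws from the normalised restriction of \<open>\<nu>\<close> to the region above
    it. This suggests, and Poisson counts prove also in the presence of atoms, that for \<open>l \<ge> 1\<close> the
    probability that \<open>\<Delta>\<^sub>t\<close> of rank \<open>r\<close> exceeds \<open>l\<close> times the one of rank \<open>k + 1\<close> is
    \<open>E (\<phi> (g (V / t) / (V / t)))\<close>, where \<open>V\<close> has the Gamma law with shape \<open>k + 1\<close>,
    \<open>\<phi> p\<close> is the probability that a binomial variable with parameters \<open>k\<close> and \<open>p\<close> is at least \<open>r\<close>,
    and \<open>g v = T (l T\<^sup>- v)\<close> (lemma \<open>prob_ratio\<close>).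

  \<^item> \<^emph>\<open>A Tauberian argument.\<close> If these expectations converge as \<open>t \<down> 0\<close>, then so does
    \<open>g v / v\<close> as \<open>v \<rightarrow> \<infinity>\<close>. Replacing \<open>t\<close> by \<open>(j + 1) t\<close> amounts to inserting the weight
    \<open>exp (- j V)\<close>, so by the Weierstrass theorem one may insert any continuous function of
    \<open>exp (- V)\<close>, in particular a bump that keeps \<open>V\<close> in a short interval \<open>(1, 1 + e)\<close>. On that
    scale the nondecreasing function \<open>g\<close> is squeezed between its values at the end points, and
    the strictly increasing \<open>\<phi>\<close> can be inverted (lemmas \<open>tauberian_exp\<close>, \<open>tauberian_ratio_limit\<close>).

  \<^item> \<^emph>\<open>The multiplicative structure of the limits.\<close> Consequently \<open>T (l x) / T x\<close> has a limit \<open>p l\<close>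
    with \<open>\<phi> (p l) = P (Y > l)\<close> for every \<open>l > 1\<close> that is not an atom of \<open>Y\<close>, that is, for all but
    countably many \<open>l > 1\<close>. If all these limits are positive, the numbers \<open>l\<close> with a positive limit
    form a multiplicative group that contains a co-countable subset of the half-line, hence the
    group is everything, and the monotone multiplicative limit function is a power
    \<open>l powr (- \<alpha>)\<close>. When \<open>\<alpha> = 0\<close> all limits are 1 and \<open>Y\<close> is infinite; when \<open>\<alpha> > 0\<close> the
    function \<open>l \<mapsto> P (Y > l)\<close> decreases strictly off the atoms, so \<open>Y\<close> charges the open interval
    \<open>(1, \<infinity>)\<close>. If some limit is 0, then taking powers shows that all of them are, so \<open>Y = 1\<close>
    and the tail varies rapidly.\<close>

section \<open>Binomial and Poisson tail probabilities\<close>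

text \<open>The probability that a binomial variable with parameters \<open>N\<close> and \<open>p\<close> is at least \<open>r\<close>; as a
  function of \<open>p\<close> it is the distribution function of the Beta law with parameters \<open>r\<close> and
  \<open>N - r + 1\<close>. The polynomial form is used because it is continuous and differentiable on the whole
  line.\<close>

definition binomial_tail :: "nat \<Rightarrow> nat \<Rightarrow> real \<Rightarrow> real" where
  "binomial_tail N r p = (\<Sum>j=r..N. real (N choose j) * p ^ j * (1 - p) ^ (N - j))"

text \<open>The derivatives of consecutive summands telescope, and only the Beta density remains.\<close>

lemma binomial_tail_has_derivative:
  assumes "1 \<le> r" "r \<le> N"
  shows "(binomial_tail N r has_real_derivative
           real r * real (N choose r) * p ^ (r - 1) * (1 - p) ^ (N - r)) (at p)"
  using assms(2,1)
proof (induction r rule: inc_induct)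
  case base
  have "binomial_tail N N = (\<lambda>p. p ^ N)"
    by (simp add: binomial_tail_def fun_eq_iff)
  then show ?case by (auto intro!: derivative_eq_intros)
next
  case (step r)
  have split: "binomial_tail N r =
      (\<lambda>p. real (N choose r) * p ^ r * (1 - p) ^ (N - r) + binomial_tail N (Suc r) p)"
    using step.hyps by (simp add: binomial_tail_def fun_eq_iff sum.atLeast_Suc_atMost)
  have absorb: "real (Suc r) * real (N choose Suc r) = real (N - r) * real (N choose r)"
    using binomial_absorb_comp[of N r] binomial_absorption[of r N] by (metis of_nat_mult)
  have IH: "(binomial_tail N (Suc r) has_real_derivative
       real (N - r) * real (N choose r) * p ^ r * (1 - p) ^ (N - Suc r)) (at p)"
    using step.IH unfolding absorb by simp
  show ?case unfolding split
    by (rule derivative_eq_intros IH refl)+ (simp add: algebra_simps)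
qed

lemma binomial_tail_strict_mono:
  assumes "1 \<le> r" "r \<le> N" "0 \<le> p" "p < q" "q \<le> 1"
  shows "binomial_tail N r p < binomial_tail N r q"
proof (rule DERIV_pos_imp_increasing_open[OF assms(4)])
  fix x assume "p < x" "x < q"
  then have "0 < real r * real (N choose r) * x ^ (r - 1) * (1 - x) ^ (N - r)"
    using assms by (auto intro!: mult_pos_pos zero_less_power)
  then show "\<exists>y. (binomial_tail N r has_real_derivative y) (at x) \<and> 0 < y"
    using binomial_tail_has_derivative[OF assms(1,2)] by blast
next
  show "continuous_on {p..q} (binomial_tail N r)"
    unfolding binomial_tail_def by (intro continuous_intros)
qed

lemma binomial_tail_mono:
  assumes "1 \<le> r" "r \<le> N" "0 \<le> p" "p \<le> q" "q \<le> 1"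
  shows "binomial_tail N r p \<le> binomial_tail N r q"
  using binomial_tail_strict_mono[OF assms(1,2,3) _ assms(5)] assms(4)
  by (cases "p = q") (auto intro: less_imp_le)

lemma continuous_on_binomial_tail [continuous_intros]:
  "continuous_on A f \<Longrightarrow> continuous_on A (\<lambda>x. binomial_tail N r (f x))"
  unfolding binomial_tail_def by (intro continuous_intros)

lemma binomial_tail_0: "1 \<le> r \<Longrightarrow> binomial_tail N r 0 = 0"
  by (auto simp: binomial_tail_def intro!: sum.neutral)

lemma binomial_tail_1: "r \<le> N \<Longrightarrow> binomial_tail N r 1 = 1"
proof -
  assume "r \<le> N"
  have "binomial_tail N r 1 = (\<Sum>j=r..N. if j = N then 1 else 0)"
    unfolding binomial_tail_def by (intro sum.cong) auto
  then show ?thesis using \<open>r \<le> N\<close> by simp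
qed

lemma binomial_tail_bounds:
  assumes "1 \<le> r" "r \<le> N" "0 \<le> p" "p \<le> 1"
  shows "0 \<le> binomial_tail N r p" "binomial_tail N r p \<le> 1"
  using binomial_tail_mono[of r N 0 p] binomial_tail_mono[of r N p 1] assms
  by (auto simp: binomial_tail_0 binomial_tail_1)

lemma binomial_tail_surj:
  assumes "1 \<le> r" "r \<le> k" "0 \<le> G" "G \<le> 1"
  obtains p where "0 \<le> p" "p \<le> 1" "binomial_tail k r p = G"
  using IVT'[of "binomial_tail k r" 0 G 1] continuous_on_binomial_tail[OF continuous_on_id, of "{0..1}" k r] assms
  by (auto simp: binomial_tail_0 binomial_tail_1)

text \<open>Parameter 0 is included, with \<open>0 ^ 0 = 1\<close>: it occurs for an interval without mass.\<close>

definition poisson_weight :: "real \<Rightarrow> nat \<Rightarrow> real" where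
  "poisson_weight l k = exp (- l) * l ^ k / fact k"

lemma poisson_cdf_has_derivative:
  "((\<lambda>l. \<Sum>i<Suc K. poisson_weight l i) has_real_derivative - poisson_weight l K) (at l)"
proof (induction K)
  case 0
  then show ?case by (auto simp: poisson_weight_def intro!: derivative_eq_intros)
next
  case (Suc K)
  have "((\<lambda>l. poisson_weight l (Suc K)) has_real_derivative
          poisson_weight l K - poisson_weight l (Suc K)) (at l)"
    unfolding poisson_weight_def
    by (rule derivative_eq_intros refl)+ (simp_all add: divide_simps del: fact_Suc, simp add: algebra_simps)
  from DERIV_add[OF Suc this] show ?case by simp
qed

text \<open>The probability that \<open>A \<ge> r\<close> and \<open>A + B < m\<close> for independent Poisson variables \<open>A\<close> and \<open>B\<close> with
  means \<open>a\<close> and \<open>b - a\<close>.\<close>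

definition poisson_split_prob :: "nat \<Rightarrow> nat \<Rightarrow> real \<Rightarrow> real \<Rightarrow> real" where
  "poisson_split_prob r m a b =
     (\<Sum>j=r..<m. poisson_weight a j * (\<Sum>i<m - j. poisson_weight (b - a) i))"

text \<open>A Poisson number of points that is known to be \<open>N\<close> splits binomially between the two parts.\<close>

lemma poisson_weight_binomial:
  assumes "j \<le> N" "b > 0"
  shows "poisson_weight a j * poisson_weight (b - a) (N - j) =
     poisson_weight b N * (real (N choose j) * (a / b) ^ j * (1 - a / b) ^ (N - j))"
proof -
  have *: "b ^ N = b ^ j * b ^ (N - j)"
    using assms by (simp flip: power_add)
  have "1 - a / b = (b - a) / b" using assms by (simp add: field_simps)
  then have "poisson_weight b N * (real (N choose j) * (a / b) ^ j * (1 - a / b) ^ (N - j)) =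
     exp (-b) * real (N choose j) * a ^ j * (b - a) ^ (N - j) / fact N"
    using assms by (simp add: poisson_weight_def power_divide * )
  also have "\<dots> = poisson_weight a j * poisson_weight (b - a) (N - j)"
    using assms by (simp add: poisson_weight_def binomial_fact mult_exp_exp)
  finally show ?thesis ..
qed

text \<open>When \<open>b\<close> grows, the event \<open>A + B < Suc N\<close> is left through \<open>A + B = N\<close>, which happens at a rate given
  by the Erlang density; given \<open>A + B = N\<close>, the variable \<open>A\<close> is binomial.\<close>

lemma poisson_split_prob_has_derivative:
  assumes "r \<le> N" "b > 0"
  shows "(poisson_split_prob r (Suc N) a has_real_derivative
            - (erlang_density N 1 b * binomial_tail N r (a / b))) (at b)"
proof -
  have "((\<lambda>b. \<Sum>i<Suc N - j. poisson_weight (b - a) i) has_real_derivative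
           - poisson_weight (b - a) (N - j)) (at b)" if "j \<in> {r..<Suc N}" for j
  proof -
    have "Suc N - j = Suc (N - j)" using that by auto
    then show ?thesis
      using DERIV_chain2[where f = "\<lambda>l. \<Sum>i<Suc (N - j). poisson_weight l i" and g = "\<lambda>b. b - a"
          and Db = 1 and x = b and s = UNIV, OF poisson_cdf_has_derivative]
      by (simp add: DERIV_const DERIV_ident DERIV_diff[OF DERIV_ident DERIV_const, simplified] del: sum.lessThan_Suc)
  qed
  then have "(poisson_split_prob r (Suc N) a has_real_derivative
      (\<Sum>j=r..<Suc N. poisson_weight a j * - poisson_weight (b - a) (N - j))) (at b)"
    unfolding poisson_split_prob_def[abs_def]
    by (intro DERIV_sum DERIV_cmult) auto
  also have "(\<Sum>j=r..<Suc N. poisson_weight a j * - poisson_weight (b - a) (N - j)) =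
      - (\<Sum>j=r..N. poisson_weight b N * (real (N choose j) * (a / b) ^ j * (1 - a / b) ^ (N - j)))"
    by (simp add: sum_negf atLeastLessThanSuc_atLeastAtMost)
       (intro sum.cong poisson_weight_binomial assms, auto)
  also have "\<dots> = - (erlang_density N 1 b * binomial_tail N r (a / b))"
    using assms by (simp add: binomial_tail_def sum_distrib_left erlang_density_def poisson_weight_def mult_ac)
  finally show ?thesis .
qed

lemma nn_integral_erlang_binomial_tail:
  assumes "1 \<le> r" "r \<le> N" "0 \<le> a" "a \<le> b'" "0 < b'" "b' \<le> b"
  shows "(\<integral>\<^sup>+v. ennreal (erlang_density N 1 v * binomial_tail N r (a / v)) * indicator {b'..b} v \<partial>lborel)
       = ennreal (poisson_split_prob r (Suc N) a b' - poisson_split_prob r (Suc N) a b)"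
proof -
  have "(\<integral>\<^sup>+v. ennreal (erlang_density N 1 v * binomial_tail N r (a / v)) * indicator {b'..b} v \<partial>lborel)
      = ennreal (- poisson_split_prob r (Suc N) a b - - poisson_split_prob r (Suc N) a b')"
  proof (rule nn_integral_FTC_Icc)
    show "(\<lambda>v. erlang_density N 1 v * binomial_tail N r (a / v)) \<in> borel_measurable borel"
      unfolding binomial_tail_def by measurable
    show "((\<lambda>x. - poisson_split_prob r (Suc N) a x) has_real_derivative
        erlang_density N 1 x * binomial_tail N r (a / x)) (at x)" if "x \<in> {b'..b}" for x
      using DERIV_minus[OF poisson_split_prob_has_derivative[of r N x a]] assms that by simp
    show "0 \<le> erlang_density N 1 x * binomial_tail N r (a / x)" if "x \<in> {b'..b}" for x
      using assms that by (intro mult_nonneg_nonneg binomial_tail_bounds) auto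
  qed (use assms in auto)
  then show ?thesis by simp
qed


section \<open>Counting points\<close>

lemma num_points_add:
  assumes "B \<inter> C = {}"
  shows "num_points x (B \<union> C) = num_points x B + num_points x C"
proof -
  let ?S = "\<lambda>B. {i. 1 \<le> i \<and> x i \<in> B}"
  have "?S (B \<union> C) = ?S B \<union> ?S C" "?S B \<inter> ?S C = {}" using assms by auto
  then show ?thesis by (simp add: num_points_def card_Un_disjoint)
qed

text \<open>The indices of the points above \<open>a\<close> form an initial segment of the positive integers.\<close>

lemma less_iff_num_points:
  assumes "\<forall>i\<ge>1. x i \<ge> x (Suc i)" "k \<ge> 1"
  shows "a < x k \<longleftrightarrow> enat k \<le> num_points x {a<..}"
proof -
  let ?S = "{i. 1 \<le> i \<and> a < x i}"
  have mono: "x j \<le> x i" if "1 \<le> i" "i \<le> j" for i j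
    using that(2) by (induction j rule: dec_induct) (use assms(1) that(1) in \<open>auto intro: order_trans\<close>)
  show ?thesis
  proof
    assume "a < x k"
    then have "{1..k} \<subseteq> ?S" using mono[of _ k] by (auto intro: less_le_trans)
    then show "enat k \<le> num_points x {a<..}"
      using card_mono[of ?S "{1..k}"] by (auto simp: num_points_def)
  next
    assume le: "enat k \<le> num_points x {a<..}"
    show "a < x k"
    proof (rule ccontr)
      assume "\<not> a < x k"
      then have sub: "?S \<subseteq> {1..<k}" using mono[of k] assms(2)
        by (auto simp: not_less) (meson leI le_less_trans less_le_not_le order_trans)
      then have "finite ?S" "card ?S \<le> k - 1"
        using card_mono[OF _ sub] finite_subset[OF sub] by auto
      with le assms(2) show False by (auto simp: num_points_def)
    qed
  qed
qed

section \<open>The tail function and its generalised inverse\<close>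

lemma borel_measurable_antimono_positive:
  fixes f :: "real \<Rightarrow> real"
  assumes "\<And>x y. 0 < x \<Longrightarrow> x \<le> y \<Longrightarrow> f y \<le> f x" "\<And>x. x \<le> 0 \<Longrightarrow> f x = c"
  shows "f \<in> borel_measurable borel"
proof -
  have "mono_on {0<..} (\<lambda>v. - f v)"
    using assms(1) by (intro mono_onI) simp
  then have "(\<lambda>v. - f v) \<in> borel_measurable (restrict_space borel {0<..})"
    by (rule borel_measurable_mono_on_fnc)
  then have "(\<lambda>v. if v \<in> {0<..} then - f v else - c) \<in> borel_measurable borel"
    by (subst measurable_If_restrict_space_iff) (auto simp: greaterThan_def simp del: borel_measurable_uminus_eq)
  then have "(\<lambda>v. - (if v \<in> {0<..} then - f v else - c)) \<in> borel_measurable borel"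
    by (rule borel_measurable_uminus)
  also have "(\<lambda>v. - (if v \<in> {0<..} then - f v else - c)) = f"
    using assms(2) by (auto simp: fun_eq_iff)
  finally show ?thesis .
qed

locale tail_measure =
  fixes \<mu> :: "real measure"
  assumes sets_mu: "sets \<mu> = sets (restrict_space borel {0<..})"
    and tail_finite: "\<And>x. x > 0 \<Longrightarrow> 0 < emeasure \<mu> {x<..} \<and> emeasure \<mu> {x<..} < \<infinity>"
    and tail_infinite: "emeasure \<mu> {0<..} = \<infinity>"
begin

lemma sets_mu_iff: "A \<in> sets \<mu> \<longleftrightarrow> A \<in> sets borel \<and> A \<subseteq> {0<..}"
  using sets_restrict_space_iff[of "{0<..}" borel A] by (auto simp: sets_mu)

lemma greaterThan_in_sets [simp]: "0 \<le> x \<Longrightarrow> {x<..} \<in> sets \<mu>"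
  by (auto simp: sets_mu_iff)

lemma emeasure_eq_tail: "x > 0 \<Longrightarrow> emeasure \<mu> {x<..} = ennreal (tail \<mu> x)"
  using tail_finite[of x] by (simp add: tail_def emeasure_eq_ennreal_measure less_top)

lemma tail_pos: "x > 0 \<Longrightarrow> 0 < tail \<mu> x"
  using tail_finite[of x] by (simp add: emeasure_eq_tail)

lemma tail_antimono: "0 < x \<Longrightarrow> x \<le> y \<Longrightarrow> tail \<mu> y \<le> tail \<mu> x"
  using emeasure_mono[of "{y<..}" "{x<..}" \<mu>] tail_pos[of x] by (simp add: emeasure_eq_tail)

lemma emeasure_interval_eq_tail:
  assumes "0 < y" "y \<le> x"
  shows "emeasure \<mu> {y<..x} = ennreal (tail \<mu> y - tail \<mu> x)"
proof -
  have "{y<..x} = {y<..} - {x<..}" by auto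
  then have "emeasure \<mu> {y<..x} = emeasure \<mu> {y<..} - emeasure \<mu> {x<..}"
    using assms tail_finite[of x] by (simp add: emeasure_Diff less_top subset_iff)
  then show ?thesis
    using assms tail_pos[of x] by (simp add: emeasure_eq_tail ennreal_minus)
qed

lemma tail_unbounded: "\<exists>x>0. K < tail \<mu> x"
proof -
  have "(\<lambda>i. emeasure \<mu> {1 / Suc i<..}) \<longlonglongrightarrow> emeasure \<mu> (\<Union>i. {1 / Suc i<..})"
    by (intro Lim_emeasure_incseq) (auto simp: incseq_def frac_le intro: le_less_trans[rotated])
  also have "(\<Union>i. {1 / real (Suc i)<..}) = {0<..}"
  proof -
    have "\<exists>i. 1 / real (Suc i) < y" if "0 < y" for y
      using reals_Archimedean[OF that] by (simp add: inverse_eq_divide)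
    moreover have "0 < 1 / real (Suc i)" for i by simp
    ultimately show ?thesis by (blast intro: less_trans)
  qed
  finally have "(\<lambda>i. emeasure \<mu> {1 / Suc i<..}) \<longlonglongrightarrow> \<infinity>" by (simp add: tail_infinite)
  then have "eventually (\<lambda>i. emeasure \<mu> {1 / Suc i<..} > ennreal K) sequentially"
    by (rule order_tendstoD) (simp add: ennreal_less_top)
  then obtain i where "ennreal K < emeasure \<mu> {1 / Suc i<..}"
    by (auto simp: eventually_sequentially)
  then show ?thesis
    by (intro exI[of _ "1 / Suc i"]) (use le_less_trans ennreal_leI in \<open>fastforce simp: emeasure_eq_tail not_le[symmetric]\<close>)
qed

lemma tail_vanishes:
  assumes "0 < e" shows "\<exists>x>0. tail \<mu> x < e"
proof -
  have "(\<lambda>i. emeasure \<mu> {real (Suc i)<..}) \<longlonglongrightarrow> emeasure \<mu> (\<Inter>i. {real (Suc i)<..})"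
    using tail_finite by (intro Lim_emeasure_decseq) (auto simp: decseq_def emeasure_eq_tail)
  also have "(\<Inter>i. {real (Suc i)<..}) = {}"
  proof -
    have "\<exists>i. \<not> real (Suc i) < x" for x
      using real_arch_simple[of x] by (metis not_less of_nat_Suc add_increasing zero_le_one)
    then show ?thesis by blast
  qed
  finally have "(\<lambda>i. emeasure \<mu> {real (Suc i)<..}) \<longlonglongrightarrow> 0" by simp
  then have "eventually (\<lambda>i. emeasure \<mu> {real (Suc i)<..} < ennreal e) sequentially"
    by (rule order_tendstoD) (use assms in simp)
  then obtain i where "emeasure \<mu> {real (Suc i)<..} < ennreal e"
    by (auto simp: eventually_sequentially)
  then show ?thesis
    by (intro exI[of _ "real (Suc i)"]) (simp add: emeasure_eq_tail ennreal_less_iff measure_nonneg tail_def)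
qed

lemma tail_right_continuous:
  assumes "0 < x" shows "(tail \<mu> \<longlongrightarrow> tail \<mu> x) (at_right x)"
proof (rule order_tendstoI)
  fix c assume "c < tail \<mu> x"
  have "(\<lambda>i. emeasure \<mu> {x + 1 / Suc i<..}) \<longlonglongrightarrow> emeasure \<mu> (\<Union>i. {x + 1 / Suc i<..})"
    using assms
    by (intro Lim_emeasure_incseq) (auto simp: incseq_def frac_le intro: le_less_trans[rotated])
  also have "(\<Union>i. {x + 1 / real (Suc i)<..}) = {x<..}"
  proof -
    have "\<exists>i. x + 1 / real (Suc i) < y" if "x < y" for y
      using reals_Archimedean[of "y - x"] that by (auto simp: inverse_eq_divide algebra_simps)
    moreover have "x < x + 1 / real (Suc i)" for i by simp
    ultimately show ?thesis by (blast intro: less_trans)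
  qed
  finally have "(\<lambda>i. ennreal (tail \<mu> (x + 1 / Suc i))) \<longlonglongrightarrow> ennreal (tail \<mu> x)"
    using assms by (simp add: emeasure_eq_tail add_pos_pos)
  then have "(\<lambda>i. tail \<mu> (x + 1 / Suc i)) \<longlonglongrightarrow> tail \<mu> x"
    using assms by (simp add: tail_def)
  then have "eventually (\<lambda>i. c < tail \<mu> (x + 1 / Suc i)) sequentially"
    using \<open>c < tail \<mu> x\<close> by (rule order_tendstoD)
  then obtain i where i: "c < tail \<mu> (x + 1 / Suc i)" by (auto simp: eventually_sequentially)
  show "\<forall>\<^sub>F y in at_right x. c < tail \<mu> y"
    unfolding eventually_at_right_field
  proof (intro exI[of _ "x + 1 / Suc i"] conjI allI impI)
    fix y assume "x < y" "y < x + 1 / real (Suc i)"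
    then show "c < tail \<mu> y" using i tail_antimono[of y "x + 1 / Suc i"] assms by linarith
  qed simp
next
  fix c assume "tail \<mu> x < c"
  then show "\<forall>\<^sub>F y in at_right x. tail \<mu> y < c"
    unfolding eventually_at_right_field
  proof (intro exI[of _ "x + 1"] conjI allI impI)
    fix y assume "tail \<mu> x < c" "x < y"
    then show "tail \<mu> y < c" using tail_antimono[of x y] assms by linarith
  qed simp
qed

lemma tail_right_continuous_sequentially:
  assumes "0 < x" "y \<longlonglongrightarrow> x" "\<And>i. x \<le> y i"
  shows "(\<lambda>i. tail \<mu> (y i)) \<longlonglongrightarrow> tail \<mu> x"
proof -
  have "(tail \<mu> \<longlongrightarrow> tail \<mu> x) (at x within {x..})"
    using tail_right_continuous[OF assms(1)]
    by (simp add: at_within_Ici_at_right)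
  then have "continuous (at x within {x..}) (tail \<mu>)" by (simp add: continuous_within)
  then show ?thesis
    using assms by (auto simp: continuous_within_sequentially o_def)
qed

text \<open>The fixed value 0 for \<open>v \<le> 0\<close> keeps the function Borel on the whole line.\<close>

definition tail_inv :: "real \<Rightarrow> real" where
  "tail_inv v = (if v > 0 then Inf {x. 0 < x \<and> tail \<mu> x \<le> v} else 0)"

text \<open>The Galois connection between a tail function and its inverse. Right continuity of the tail is what
  puts the infimum itself into the set.\<close>

lemma tail_inv_le_iff:
  assumes "0 < v" "0 < x"
  shows "tail_inv v \<le> x \<longleftrightarrow> tail \<mu> x \<le> v"
proof
  let ?A = "{x. 0 < x \<and> tail \<mu> x \<le> v}"
  have bdd: "bdd_below ?A" by (intro bdd_belowI[of _ 0]) auto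
  show "tail_inv v \<le> x" if "tail \<mu> x \<le> v"
    using assms that unfolding tail_inv_def by (auto intro!: cInf_lower bdd)
  show "tail \<mu> x \<le> v" if "tail_inv v \<le> x"
  proof (rule tendsto_upperbound[OF tail_right_continuous[OF assms(2)]])
    have ne: "?A \<noteq> {}" using tail_vanishes[OF assms(1)] by (auto intro: less_imp_le)
    have "tail \<mu> y \<le> v" if "x < y" for y
    proof -
      have "Inf ?A < y" using \<open>tail_inv v \<le> x\<close> assms that by (simp add: tail_inv_def)
      then obtain z where "z \<in> ?A" "z < y" using cInf_lessD[OF ne] by blast
      then show ?thesis using tail_antimono[of z y] by auto
    qed
    then show "\<forall>\<^sub>F y in at_right x. tail \<mu> y \<le> v"
      by (auto simp: eventually_at_right_field intro!: exI[of _ "x + 1"])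
  qed auto
qed

lemma tail_inv_pos: "0 < v \<Longrightarrow> 0 < tail_inv v"
proof -
  assume v: "0 < v"
  obtain x where "x > 0" "v < tail \<mu> x" using tail_unbounded by blast
  then show ?thesis using tail_inv_le_iff[OF v, of x] by linarith
qed

lemma tail_tail_inv_le:
  assumes "0 < v" shows "tail \<mu> (tail_inv v) \<le> v"
  using tail_inv_le_iff[OF assms tail_inv_pos[OF assms]] by blast

lemma tail_ratio_bounds:
  assumes "0 < v" "tail_inv v \<le> x"
  shows "0 \<le> tail \<mu> x / v" "tail \<mu> x / v \<le> 1"
proof -
  have "0 < x" using tail_inv_pos[OF assms(1)] assms(2) by linarith
  then have "tail \<mu> x \<le> v" using assms tail_inv_le_iff by blast
  with assms(1) tail_pos[OF \<open>0 < x\<close>] show "0 \<le> tail \<mu> x / v" "tail \<mu> x / v \<le> 1" by auto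
qed

lemma tail_inv_antimono:
  assumes "0 < v" "v \<le> w" shows "tail_inv w \<le> tail_inv v"
proof -
  have "0 < w" using assms by linarith
  show ?thesis
    unfolding tail_inv_le_iff[OF \<open>0 < w\<close> tail_inv_pos[OF assms(1)]]
    using tail_tail_inv_le[OF assms(1)] assms(2) by linarith
qed

lemma borel_measurable_tail_inv [measurable]: "tail_inv \<in> borel_measurable borel"
  by (rule borel_measurable_antimono_positive[OF tail_inv_antimono]) (auto simp: tail_inv_def)

text \<open>At 0 the measure of the half-line is infinite, and below 0 the half-line is not a measurable set;
  in both cases the real-valued measure is 0 by convention.\<close>

lemma borel_measurable_tail [measurable]: "tail \<mu> \<in> borel_measurable borel"
proof (rule borel_measurable_antimono_positive[OF tail_antimono])
  fix x :: real assume "x \<le> 0"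
  show "tail \<mu> x = 0"
  proof (cases "x = 0")
    case False
    then have "{x<..} \<notin> sets \<mu>"
      using \<open>x \<le> 0\<close> by (auto simp: sets_mu_iff subset_iff intro!: exI[of _ "x / 2"])
    then show ?thesis by (simp add: tail_def measure_notin_sets)
  qed (simp add: tail_def measure_def tail_infinite)
qed

end


section \<open>The joint law of two order statistics\<close>

locale ordered_poisson_points = prob_space M + tail_measure \<mu>
  for M :: "'a measure" and \<mu> :: "real measure" +
  fixes X :: "nat \<Rightarrow> 'a \<Rightarrow> real"
  assumes ordered_ppp: "ordered_ppp M X \<mu>"
begin

definition points_in :: "real set \<Rightarrow> 'a \<Rightarrow> enat" where
  "points_in B \<omega> = num_points (\<lambda>i. X i \<omega>) B"

lemma X_measurable: "i \<ge> 1 \<Longrightarrow> X i \<in> borel_measurable M"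
  using ordered_ppp by (simp add: ordered_ppp_def)

lemma AE_X: "AE \<omega> in M. \<forall>i\<ge>1. X i \<omega> \<ge> X (Suc i) \<omega> \<and> X (Suc i) \<omega> > 0"
  using ordered_ppp by (simp add: ordered_ppp_def)

lemma AE_less_iff_points_in: "AE \<omega> in M. \<forall>k\<ge>1. \<forall>x. x < X k \<omega> \<longleftrightarrow> enat k \<le> points_in {x<..} \<omega>"
  using AE_X unfolding points_in_def by eventually_elim (intro allI impI less_iff_num_points, auto)

lemma points_in_measurable:
  assumes "B \<in> sets \<mu>" shows "points_in B \<in> measurable M (count_space UNIV)"
  using ordered_ppp assms
  by (auto simp: ordered_ppp_def poisson_random_measure_def poisson_distributed_def points_in_def[abs_def])

lemma points_in_event: "B \<in> sets \<mu> \<Longrightarrow> {\<omega> \<in> space M. P (points_in B \<omega>)} \<in> events"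
  using measurable_sets[OF points_in_measurable, of B "Collect P"] by (simp add: vimage_def Int_def conj_commute)

lemma prob_points_in:
  assumes "B \<in> sets \<mu>" "emeasure \<mu> B = ennreal l" "0 \<le> l"
  shows "prob {\<omega> \<in> space M. points_in B \<omega> = enat k} = poisson_weight l k"
  using ordered_ppp assms
  by (auto simp: ordered_ppp_def poisson_random_measure_def poisson_distributed_def points_in_def poisson_weight_def)

lemma prob_points_in_two:
  assumes "A \<in> sets \<mu>" "B \<in> sets \<mu>" "A \<inter> B = {}"
    and "emeasure \<mu> A = ennreal a" "0 \<le> a" "emeasure \<mu> B = ennreal b" "0 \<le> b"
  shows "prob {\<omega> \<in> space M. points_in A \<omega> = enat j \<and> points_in B \<omega> = enat i} = poisson_weight a j * poisson_weight b i"
proof -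
  \<comment> \<open>independence is stated for sequences of disjoint sets, so the pair is padded with empty sets\<close>
  define C :: "nat \<Rightarrow> real set" where "C = (\<lambda>k. if k = 0 then A else if k = 1 then B else {})"
  have "range C \<subseteq> sets \<mu>" "disjoint_family C"
    using assms by (auto simp: C_def disjoint_family_on_def)
  then have "indep_vars (\<lambda>_. count_space UNIV) (\<lambda>j. points_in (C j)) UNIV"
    using ordered_ppp by (simp add: ordered_ppp_def poisson_random_measure_def points_in_def[abs_def])
  then have "prob (\<Inter>k\<in>{0, 1}. points_in (C k) -` (if k = 0 then {enat j} else {enat i}) \<inter> space M) =
      (\<Prod>k\<in>{0, 1::nat}. prob (points_in (C k) -` (if k = 0 then {enat j} else {enat i}) \<inter> space M))"
    by (rule indep_varsD) auto
  moreover have "(\<Inter>k\<in>{0, 1}. points_in (C k) -` (if k = 0 then {enat j} else {enat i}) \<inter> space M) =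
      {\<omega> \<in> space M. points_in A \<omega> = enat j \<and> points_in B \<omega> = enat i}"
    by (auto simp: C_def)
  moreover have "points_in (C 0) -` {enat j} \<inter> space M = {\<omega> \<in> space M. points_in A \<omega> = enat j}"
    "points_in (C 1) -` {enat i} \<inter> space M = {\<omega> \<in> space M. points_in B \<omega> = enat i}"
    by (auto simp: C_def)
  ultimately show ?thesis using assms by (simp add: prob_points_in)
qed

text \<open>The numbers of points in \<open>(x, \<infinity>)\<close> and in \<open>(y, x]\<close> are independent Poisson variables.\<close>

lemma prob_points_in_ge_less:
  assumes "0 < y" "y \<le> x"
  shows "prob {\<omega> \<in> space M. enat r \<le> points_in {x<..} \<omega> \<and> points_in {y<..} \<omega> < enat m} =
           poisson_split_prob r m (tail \<mu> x) (tail \<mu> y)"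
proof -
  have B: "{y<..x} \<in> sets \<mu>" using assms by (auto simp: sets_mu_iff)
  let ?I = "Sigma {r..<m} (\<lambda>j. {..<m - j})"
  let ?E = "\<lambda>(j, i). {\<omega> \<in> space M. points_in {x<..} \<omega> = enat j \<and> points_in {y<..x} \<omega> = enat i}"
  have "{y<..} = {x<..} \<union> {y<..x}" using assms by auto
  then have add: "points_in {y<..} \<omega> = points_in {x<..} \<omega> + points_in {y<..x} \<omega>" for \<omega>
    using num_points_add[of "{x<..}" "{y<..x}"] by (simp add: points_in_def Int_def)
  have "{\<omega> \<in> space M. enat r \<le> points_in {x<..} \<omega> \<and> points_in {y<..} \<omega> < enat m} = (\<Union>p\<in>?I. ?E p)"
  proof (intro set_eqI iffI)
    fix \<omega> assume "\<omega> \<in> {\<omega> \<in> space M. enat r \<le> points_in {x<..} \<omega> \<and> points_in {y<..} \<omega> < enat m}"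
    then obtain j i where "\<omega> \<in> space M" "points_in {x<..} \<omega> = enat j" "points_in {y<..x} \<omega> = enat i" "r \<le> j" "j + i < m"
      by (cases "points_in {x<..} \<omega>"; cases "points_in {y<..x} \<omega>") (auto simp: add)
    then show "\<omega> \<in> (\<Union>p\<in>?I. ?E p)" by (auto intro!: bexI[of _ "(j, i)"])
  next
    fix \<omega> assume "\<omega> \<in> (\<Union>p\<in>?I. ?E p)"
    then show "\<omega> \<in> {\<omega> \<in> space M. enat r \<le> points_in {x<..} \<omega> \<and> points_in {y<..} \<omega> < enat m}"
      by (auto simp: add)
  qed
  also have "prob \<dots> = (\<Sum>p\<in>?I. prob (?E p))"
  proof (rule finite_measure_finite_Union)
    have "?E (j, i) \<in> events" for j i
      using points_in_event[of "{x<..}" "\<lambda>z. z = enat j"] points_in_event[OF B, of "\<lambda>z. z = enat i"] assms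
        sets.Int[of "{\<omega> \<in> space M. points_in {x<..} \<omega> = enat j}" M "{\<omega> \<in> space M. points_in {y<..x} \<omega> = enat i}"]
      by (simp add: Int_def conj_ac cong: conj_cong)
    then show "?E ` ?I \<subseteq> events" by auto
    show "disjoint_family_on ?E ?I" by (auto simp: disjoint_family_on_def)
  qed auto
  also have "\<dots> = (\<Sum>(j, i)\<in>?I. poisson_weight (tail \<mu> x) j * poisson_weight (tail \<mu> y - tail \<mu> x) i)"
  proof (intro sum.cong refl, clarify)
    fix j i
    have "{x<..} \<inter> {y<..x} = {}" by auto
    then show "prob {\<omega> \<in> space M. points_in {x<..} \<omega> = enat j \<and> points_in {y<..x} \<omega> = enat i} =
        poisson_weight (tail \<mu> x) j * poisson_weight (tail \<mu> y - tail \<mu> x) i"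
      using assms B tail_antimono[of y x] tail_pos[of x]
      by (intro prob_points_in_two) (auto simp: emeasure_eq_tail emeasure_interval_eq_tail)
  qed
  also have "\<dots> = poisson_split_prob r m (tail \<mu> x) (tail \<mu> y)"
    by (simp add: sum.Sigma[symmetric] poisson_split_prob_def sum_distrib_left)
  finally show ?thesis .
qed

text \<open>The event says that at least \<open>r\<close> points lie above \<open>x\<close>, fewer than \<open>m\<close> above \<open>y'\<close>, and at least \<open>m\<close>
  above \<open>y\<close>; it is the difference of two events of the kind treated in the preceding lemma.\<close>

lemma prob_cell:
  assumes "1 \<le> r" "r \<le> m" "0 < y" "y < y'" "y' \<le> x"
  shows "prob {\<omega> \<in> space M. x < X r \<omega> \<and> y < X m \<omega> \<and> X m \<omega> \<le> y'} =
           poisson_split_prob r m (tail \<mu> x) (tail \<mu> y') - poisson_split_prob r m (tail \<mu> x) (tail \<mu> y)"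
proof -
  have [simp]: "x > 0" "y' > 0" using assms by auto
  have [measurable]: "X r \<in> borel_measurable M" "X m \<in> borel_measurable M"
    using assms by (auto intro: X_measurable)
  define E where "E z = {\<omega> \<in> space M. enat r \<le> points_in {x<..} \<omega> \<and> points_in {z<..} \<omega> < enat m}" for z
  have "0 \<le> x" using assms by linarith
  have E: "E z \<in> events" if "z > 0" for z
    using points_in_event[of "{x<..}" "\<lambda>u. enat r \<le> u"] points_in_event[of "{z<..}" "\<lambda>u. u < enat m"] that \<open>0 \<le> x\<close>
      sets.Int[of "{\<omega> \<in> space M. enat r \<le> points_in {x<..} \<omega>}" M "{\<omega> \<in> space M. points_in {z<..} \<omega> < enat m}"]
    by (simp add: Int_def conj_ac E_def cong: conj_cong)
  have sub: "E y \<subseteq> E y'"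
  proof -
    have "{y<..} = {y'<..} \<union> {y<..y'}" "{y'<..} \<inter> {y<..y'} = {}" using assms by auto
    then have "points_in {y<..} \<omega> = points_in {y'<..} \<omega> + points_in {y<..y'} \<omega>" for \<omega>
      using num_points_add[of "{y'<..}" "{y<..y'}"] by (simp add: points_in_def)
    then have "points_in {y'<..} \<omega> \<le> points_in {y<..} \<omega>" for \<omega> by simp
    then show ?thesis unfolding E_def by (auto intro: le_less_trans)
  qed
  have "prob {\<omega> \<in> space M. x < X r \<omega> \<and> y < X m \<omega> \<and> X m \<omega> \<le> y'} = prob (E y' - E y)"
  proof (rule finite_measure_eq_AE)
    show "AE \<omega> in M. \<omega> \<in> {\<omega> \<in> space M. x < X r \<omega> \<and> y < X m \<omega> \<and> X m \<omega> \<le> y'} \<longleftrightarrow> \<omega> \<in> E y' - E y"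
      using AE_less_iff_points_in
    proof eventually_elim
      case (elim \<omega>)
      then have "x < X r \<omega> \<longleftrightarrow> enat r \<le> points_in {x<..} \<omega>" "z < X m \<omega> \<longleftrightarrow> enat m \<le> points_in {z<..} \<omega>" for z
        using assms by auto
      then show ?case by (auto simp: E_def not_le[symmetric])
    qed
    show "{\<omega> \<in> space M. x < X r \<omega> \<and> y < X m \<omega> \<and> X m \<omega> \<le> y'} \<in> events"
      by measurable
    show "E y' - E y \<in> events" using E assms by auto
  qed
  also have "\<dots> = prob (E y') - prob (E y)"
    using E sub assms by (intro finite_measure_Diff) auto
  finally show ?thesis using assms by (simp add: E_def prob_points_in_ge_less)
qed

end


text \<open>The point of rank \<open>k + 1\<close> is rounded up to a geometric grid. A geometric grid has no cell that
  reaches 0, where the tail is infinite; and rounding up keeps \<open>l\<close> times the grid point above the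
  cell when \<open>l \<ge> 1\<close>, as lemma \<open>prob_cell\<close> requires.\<close>

definition log_grid :: "nat \<Rightarrow> real \<Rightarrow> real" where
  "log_grid i w = exp (of_int \<lceil>real (Suc i) * ln w\<rceil> / real (Suc i))"

lemma ceiling_ln_eq_iff:
  "\<lceil>real (Suc i) * ln w\<rceil> = j \<longleftrightarrow>
     exp ((of_int j - 1) / real (Suc i)) < w \<and> w \<le> exp (of_int j / real (Suc i))" if "0 < w"
proof -
  have "\<lceil>real (Suc i) * ln w\<rceil> = j \<longleftrightarrow>
      of_int j - 1 < real (Suc i) * ln w \<and> real (Suc i) * ln w \<le> of_int j"
    by (simp add: ceiling_eq_iff)
  also have "\<dots> \<longleftrightarrow> (of_int j - 1) / real (Suc i) < ln w \<and> ln w \<le> of_int j / real (Suc i)"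
    by (simp add: field_simps)
  also have "\<dots> \<longleftrightarrow> exp ((of_int j - 1) / real (Suc i)) < w \<and> w \<le> exp (of_int j / real (Suc i))"
    using exp_less_cancel_iff[of "(of_int j - 1) / real (Suc i)" "ln w"]
      exp_le_cancel_iff[of "ln w" "of_int j / real (Suc i)"] that by simp
  finally show ?thesis .
qed

lemma log_grid_bounds:
  assumes "0 < w"
  shows "w \<le> log_grid i w" "log_grid i w \<le> w * exp (1 / real (Suc i))"
proof -
  note * = ceiling_ln_eq_iff[OF assms, of i "\<lceil>real (Suc i) * ln w\<rceil>", simplified]
  show "w \<le> log_grid i w" using * by (simp add: log_grid_def)
  have "log_grid i w = exp ((of_int \<lceil>real (Suc i) * ln w\<rceil> - 1) / real (Suc i)) * exp (1 / real (Suc i))"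
    by (simp add: log_grid_def flip: exp_add add_divide_distrib)
  then show "log_grid i w \<le> w * exp (1 / real (Suc i))"
    using * by (simp add: less_imp_le)
qed

lemma log_grid_tendsto:
  assumes "0 < w" shows "(\<lambda>i. log_grid i w) \<longlonglongrightarrow> w"
proof (rule tendsto_sandwich)
  show "\<forall>\<^sub>F i in sequentially. w \<le> log_grid i w" "\<forall>\<^sub>F i in sequentially. log_grid i w \<le> w * exp (1 / real (Suc i))"
    using log_grid_bounds[OF assms] by auto
  have "(\<lambda>i. w * exp (1 / real (Suc i))) \<longlonglongrightarrow> w * exp 0"
    by (intro tendsto_intros LIMSEQ_Suc lim_1_over_n)
  then show "(\<lambda>i. w * exp (1 / real (Suc i))) \<longlonglongrightarrow> w" by simp
qed auto

lemma borel_measurable_log_grid [measurable]: "log_grid i \<in> borel_measurable borel"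
  unfolding log_grid_def by measurable

text \<open>The Gamma law with shape \<open>k + 1\<close> and rate 1, which is the law of the tail evaluated at the point of
  rank \<open>k + 1\<close> when the measure has no atoms.\<close>

abbreviation erlang :: "nat \<Rightarrow> real measure" where
  "erlang k \<equiv> density lborel (erlang_density k 1)"

lemma AE_erlang_pos: "AE v in erlang k. 0 < v"
proof -
  have "AE v in lborel. v \<noteq> (0::real)" by (rule AE_lborel_singleton)
  then show ?thesis
    by (subst AE_density) (auto simp: erlang_density_def elim!: eventually_mono)
qed

context ordered_poisson_points
begin

lemma AE_X_pos: "j \<ge> 1 \<Longrightarrow> AE \<omega> in M. 0 < X j \<omega>"
  using AE_X by eventually_elim (rule less_le_trans, blast+)

text \<open>The values \<open>v\<close> whose inverse falls into the cell \<open>(y, y']\<close> are those between the tails at \<open>y'\<close> and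
  \<open>y\<close>, so the difference of Poisson probabilities is an integral over exactly these \<open>v\<close>. This holds
  also if the measure has atoms, since an atom only produces an interval of values with the same
  inverse.\<close>

lemma prob_cell_erlang:
  assumes "1 \<le> r" "r \<le> k" "0 < y" "y < y'" "y' \<le> x"
  shows "emeasure M {\<omega> \<in> space M. x < X r \<omega> \<and> y < X (Suc k) \<omega> \<and> X (Suc k) \<omega> \<le> y'} =
    (\<integral>\<^sup>+v. ennreal (erlang_density k 1 v * binomial_tail k r (tail \<mu> x / v)) *
       indicator {v. 0 < v \<and> y < tail_inv v \<and> tail_inv v \<le> y'} v \<partial>lborel)"
proof -
  have pos: "0 < y'" "0 < x" using assms by auto
  have eq: "{v. 0 < v \<and> y < tail_inv v \<and> tail_inv v \<le> y'} = {tail \<mu> y'..<tail \<mu> y}"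
  proof (rule set_eqI)
    fix v
    show "v \<in> {v. 0 < v \<and> y < tail_inv v \<and> tail_inv v \<le> y'} \<longleftrightarrow> v \<in> {tail \<mu> y'..<tail \<mu> y}"
    proof (cases "0 < v")
      case True
      then show ?thesis
        using tail_inv_le_iff[OF True assms(3)] tail_inv_le_iff[OF True pos(1)] by auto
    qed (use tail_pos[OF pos(1)] in auto)
  qed
  have ne: "AE v in lborel. v \<noteq> tail \<mu> y" by (rule AE_lborel_singleton)
  have "(\<integral>\<^sup>+v. ennreal (erlang_density k 1 v * binomial_tail k r (tail \<mu> x / v)) *
       indicator {v. 0 < v \<and> y < tail_inv v \<and> tail_inv v \<le> y'} v \<partial>lborel) =
     (\<integral>\<^sup>+v. ennreal (erlang_density k 1 v * binomial_tail k r (tail \<mu> x / v)) *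
       indicator {tail \<mu> y'..tail \<mu> y} v \<partial>lborel)"
    unfolding eq
    by (rule nn_integral_cong_AE, rule eventually_mono[OF ne]) (auto split: split_indicator)
  also have "\<dots> = ennreal (poisson_split_prob r (Suc k) (tail \<mu> x) (tail \<mu> y') -
                     poisson_split_prob r (Suc k) (tail \<mu> x) (tail \<mu> y))"
    using assms pos tail_pos[OF pos(1)] less_imp_le[OF tail_pos[OF pos(2)]]
    by (intro nn_integral_erlang_binomial_tail) (auto intro: tail_antimono)
  finally show ?thesis
    using assms by (simp add: emeasure_eq_measure prob_cell)
qed

text \<open>Both sides are countably additive over the cells of the grid, and they agree on each cell.\<close>

lemma prob_grid_ratio:
  assumes "1 \<le> r" "r \<le> k" "1 \<le> l"
  shows "prob {\<omega> \<in> space M. l * log_grid i (X (Suc k) \<omega>) < X r \<omega>} =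
    (\<integral>v. binomial_tail k r (tail \<mu> (l * log_grid i (tail_inv v)) / v) \<partial>erlang k)"
proof -
  interpret E: prob_space "erlang k" by (rule prob_space_erlang_density) auto
  have [measurable]: "X r \<in> borel_measurable M" "X (Suc k) \<in> borel_measurable M"
    using assms by (auto intro: X_measurable)
  have [measurable]: "binomial_tail k r \<in> borel_measurable borel"
    unfolding binomial_tail_def by measurable
  define y where "y j = exp (of_int j / real (Suc i))" for j :: int
  have y: "0 < y j" "y (j - 1) < y j" for j by (auto simp: y_def divide_strict_right_mono)
  define A where "A j = {\<omega> \<in> space M. l * y j < X r \<omega> \<and> y (j - 1) < X (Suc k) \<omega> \<and> X (Suc k) \<omega> \<le> y j}" for j
  define B where "B j = {v. 0 < v \<and> y (j - 1) < tail_inv v \<and> tail_inv v \<le> y j}" for j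
  have cell: "\<lceil>real (Suc i) * ln w\<rceil> = j \<longleftrightarrow> y (j - 1) < w \<and> w \<le> y j" if "0 < w" for w j
    using ceiling_ln_eq_iff[OF that] by (simp add: y_def)
  have grid: "log_grid i w = y \<lceil>real (Suc i) * ln w\<rceil>" for w by (simp add: log_grid_def y_def)
  let ?f = "\<lambda>v. binomial_tail k r (tail \<mu> (l * log_grid i (tail_inv v)) / v)"
  let ?F = "\<lambda>v. ennreal (erlang_density k 1 v * ?f v)"
  have A[measurable]: "A j \<in> sets M" for j unfolding A_def by measurable
  have B[measurable]: "B j \<in> sets borel" for j unfolding B_def by measurable
  have A_eq: "A j = {\<omega> \<in> space M. 0 < X (Suc k) \<omega> \<and> \<lceil>real (Suc i) * ln (X (Suc k) \<omega>)\<rceil> = j \<and>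
      l * log_grid i (X (Suc k) \<omega>) < X r \<omega>}" for j
  proof (intro set_eqI)
    fix \<omega>
    show "\<omega> \<in> A j \<longleftrightarrow> \<omega> \<in> {\<omega> \<in> space M. 0 < X (Suc k) \<omega> \<and> \<lceil>real (Suc i) * ln (X (Suc k) \<omega>)\<rceil> = j \<and>
      l * log_grid i (X (Suc k) \<omega>) < X r \<omega>}"
    proof (cases "0 < X (Suc k) \<omega>")
      case True
      then show ?thesis unfolding A_def grid mem_Collect_eq cell[OF True, symmetric] by blast
    next
      case False
      then show ?thesis using y(1)[of "j - 1"] unfolding A_def mem_Collect_eq by linarith
    qed
  qed
  have B_eq: "B j = {v. 0 < v \<and> \<lceil>real (Suc i) * ln (tail_inv v)\<rceil> = j}" for j
    unfolding B_def using cell[OF tail_inv_pos] by blast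
  have "disjoint_family A" "disjoint_family B" "(\<Union>j. B j) = {0<..}"
    by (auto simp: disjoint_family_on_def A_eq B_eq)
  note disj = this(1,2) and UN_B = this(3)
  have cell_eq: "emeasure M (A j) = emeasure (density lborel ?F) (B j)" for j
  proof -
    have "emeasure (density lborel ?F) (B j) = (\<integral>\<^sup>+v. ?F v * indicator (B j) v \<partial>lborel)"
      by (intro emeasure_density) auto
    also have "\<dots> = (\<integral>\<^sup>+v. ennreal (erlang_density k 1 v * binomial_tail k r (tail \<mu> (l * y j) / v)) *
       indicator (B j) v \<partial>lborel)"
    proof (intro nn_integral_cong)
      fix v
      have "log_grid i (tail_inv v) = y j" if "v \<in> B j"
        using that unfolding grid by (auto simp: B_eq)
      then show "?F v * indicator (B j) v = ennreal (erlang_density k 1 v * binomial_tail k r (tail \<mu> (l * y j) / v)) *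
          indicator (B j) v" by (auto split: split_indicator)
    qed
    also have "\<dots> = emeasure M (A j)"
      unfolding A_def B_def using assms y[of j] y(1)[of "j - 1"] by (intro prob_cell_erlang[symmetric]) auto
    finally show ?thesis ..
  qed
  have f_bounds: "0 \<le> ?f v \<and> ?f v \<le> 1" if "0 < v" for v
  proof -
    have "tail_inv v \<le> l * log_grid i (tail_inv v)"
      using log_grid_bounds(1)[OF tail_inv_pos[OF that], of i] tail_inv_pos[OF that] assms(3)
        mult_mono[of 1 l "tail_inv v" "log_grid i (tail_inv v)"] by simp
    from tail_ratio_bounds[OF that this] show ?thesis
      using assms by (intro conjI binomial_tail_bounds)
  qed
  have integral_nonneg: "0 \<le> (\<integral>v. ?f v \<partial>erlang k)"
    by (rule integral_nonneg_AE, rule eventually_mono[OF AE_erlang_pos]) (use f_bounds in blast)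
  have "prob {\<omega> \<in> space M. l * log_grid i (X (Suc k) \<omega>) < X r \<omega>} = prob (\<Union>j. A j)"
  proof (rule finite_measure_eq_AE)
    show "AE \<omega> in M. \<omega> \<in> {\<omega> \<in> space M. l * log_grid i (X (Suc k) \<omega>) < X r \<omega>} \<longleftrightarrow> \<omega> \<in> (\<Union>j. A j)"
      using AE_X_pos[of "Suc k", simplified]
    proof eventually_elim
      case (elim \<omega>)
      then show ?case by (simp add: A_eq)
    qed
  qed measurable
  also have "ennreal \<dots> = (\<integral>\<^sup>+j. emeasure M (A j) \<partial>count_space UNIV)"
    unfolding emeasure_eq_measure[symmetric]
    using disj by (intro emeasure_UN_countable) auto
  also have "\<dots> = emeasure (density lborel ?F) (\<Union>j. B j)"
    unfolding cell_eq
    using disj by (intro emeasure_UN_countable[symmetric]) auto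
  also have "\<dots> = (\<integral>\<^sup>+v. ?F v * indicator {0<..} v \<partial>lborel)"
    unfolding UN_B by (intro emeasure_density) auto
  also have "\<dots> = (\<integral>\<^sup>+v. erlang_density k 1 v * ennreal (?f v) \<partial>lborel)"
  proof (rule nn_integral_cong_AE)
    have "AE v in lborel. v \<noteq> (0::real)" by (rule AE_lborel_singleton)
    then show "AE v in lborel. ?F v * indicator {0<..} v = erlang_density k 1 v * ennreal (?f v)"
      by eventually_elim (auto split: split_indicator simp: ennreal_mult' erlang_density_def)
  qed
  also have "\<dots> = (\<integral>\<^sup>+v. ennreal (?f v) \<partial>erlang k)"
    by (intro nn_integral_density[symmetric]) auto
  also have "\<dots> = ennreal (\<integral>v. ?f v \<partial>erlang k)"
  proof (rule nn_integral_eq_integral)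
    have "AE v in erlang k. norm (?f v) \<le> 1"
      by (rule eventually_mono[OF AE_erlang_pos]) (use f_bounds in force)
    then show "integrable (erlang k) ?f"
      by (rule E.integrable_const_bound[of _ 1]) measurable
    show "AE v in erlang k. 0 \<le> ?f v"
      by (rule eventually_mono[OF AE_erlang_pos]) (use f_bounds in blast)
  qed
  finally show ?thesis
    using integral_nonneg by (simp add: measure_nonneg)
qed

text \<open>Refining the grid: the rounded values approach the true ones from above, so the events converge
  because the inequality is strict, and the integrands converge because the tail is right
  continuous.\<close>

lemma prob_ratio:
  assumes "1 \<le> r" "r \<le> k" "1 \<le> l"
  shows "prob {\<omega> \<in> space M. l * X (Suc k) \<omega> < X r \<omega>} =
    (\<integral>v. binomial_tail k r (tail \<mu> (l * tail_inv v) / v) \<partial>erlang k)"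
proof -
  interpret E: prob_space "erlang k" by (rule prob_space_erlang_density) auto
  have [measurable]: "X r \<in> borel_measurable M" "X (Suc k) \<in> borel_measurable M"
    using assms by (auto intro: X_measurable)
  have [measurable]: "binomial_tail k r \<in> borel_measurable borel"
    unfolding binomial_tail_def by measurable
  let ?I = "\<lambda>w \<omega>. indicator {\<omega> \<in> space M. l * w (X (Suc k) \<omega>) < X r \<omega>} \<omega> :: real"
  have "(\<lambda>i. expectation (?I (log_grid i))) \<longlonglongrightarrow> expectation (?I (\<lambda>x. x))"
  proof (rule integral_dominated_convergence[where w = "\<lambda>_. 1"])
    show "AE \<omega> in M. (\<lambda>i. ?I (log_grid i) \<omega>) \<longlonglongrightarrow> ?I (\<lambda>x. x) \<omega>"
      using AE_X_pos[of "Suc k", simplified] AE_space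
    proof eventually_elim
      case (elim \<omega>)
      show ?case
      proof (cases "l * X (Suc k) \<omega> < X r \<omega>")
        case True
        have "(\<lambda>i. l * log_grid i (X (Suc k) \<omega>)) \<longlonglongrightarrow> l * X (Suc k) \<omega>"
          using log_grid_tendsto[OF elim(1)] by (intro tendsto_intros)
        then have "\<forall>\<^sub>F i in sequentially. l * log_grid i (X (Suc k) \<omega>) < X r \<omega>"
          using True by (rule order_tendstoD)
        then have "\<forall>\<^sub>F i in sequentially. ?I (log_grid i) \<omega> = ?I (\<lambda>x. x) \<omega>"
          by eventually_elim (use True in \<open>auto split: split_indicator\<close>)
        then show ?thesis by (rule tendsto_eventually)
      next
        case False
        have "\<not> l * log_grid i (X (Suc k) \<omega>) < X r \<omega>" for i
          using False log_grid_bounds(1)[OF elim(1), of i] assms(3)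
            mult_left_mono[of "X (Suc k) \<omega>" "log_grid i (X (Suc k) \<omega>)" l] by linarith
        then show ?thesis using False by simp
      qed
    qed
  qed (auto split: split_indicator)
  then have lim1: "(\<lambda>i. prob {\<omega> \<in> space M. l * log_grid i (X (Suc k) \<omega>) < X r \<omega>})
      \<longlonglongrightarrow> prob {\<omega> \<in> space M. l * X (Suc k) \<omega> < X r \<omega>}"
    by simp
  let ?f = "\<lambda>w v. binomial_tail k r (tail \<mu> (l * w (tail_inv v)) / v)"
  have lim2: "(\<lambda>i. \<integral>v. ?f (log_grid i) v \<partial>erlang k) \<longlonglongrightarrow> (\<integral>v. ?f (\<lambda>x. x) v \<partial>erlang k)"
  proof (rule integral_dominated_convergence[where w = "\<lambda>_. 1"])
    show "AE v in erlang k. (\<lambda>i. ?f (log_grid i) v) \<longlonglongrightarrow> ?f (\<lambda>x. x) v"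
      using AE_erlang_pos
    proof eventually_elim
      case (elim v)
      note pos = tail_inv_pos[OF elim]
      have "(\<lambda>i. l * log_grid i (tail_inv v)) \<longlonglongrightarrow> l * tail_inv v"
        by (intro tendsto_intros log_grid_tendsto pos)
      moreover have "l * tail_inv v \<le> l * log_grid i (tail_inv v)" for i
        using log_grid_bounds(1)[OF pos] assms(3) by simp
      ultimately have "(\<lambda>i. tail \<mu> (l * log_grid i (tail_inv v))) \<longlonglongrightarrow> tail \<mu> (l * tail_inv v)"
        using tail_right_continuous_sequentially[of "l * tail_inv v"] pos assms(3) by simp
      then show ?case
        unfolding binomial_tail_def by (intro tendsto_intros) (use elim in auto)
    qed
    show "AE v in erlang k. norm (?f (log_grid i) v) \<le> 1" for i
      using AE_erlang_pos
    proof eventually_elim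
      case (elim v)
      note pos = tail_inv_pos[OF elim]
      have "tail_inv v \<le> l * log_grid i (tail_inv v)"
        using log_grid_bounds(1)[OF pos, of i] pos assms(3)
          mult_mono[of 1 l "tail_inv v" "log_grid i (tail_inv v)"] by simp
      from tail_ratio_bounds[OF elim this] show ?case
        using assms binomial_tail_bounds[of r k "tail \<mu> (l * log_grid i (tail_inv v)) / v"] by simp
    qed
  qed auto
  show ?thesis
    using LIMSEQ_unique[OF lim1] lim2 assms by (simp add: prob_grid_ratio)
qed

end


section \<open>A Tauberian theorem for Gamma averages\<close>

text \<open>An exponential weight \<open>exp (- j v)\<close> only changes the rate of the Gamma law, which is a rescaling of
  the argument.\<close>

lemma erlang_integral_exp_weight:
  fixes f :: "real \<Rightarrow> real"
  assumes [measurable]: "f \<in> borel_measurable borel"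
  shows "(\<integral>v. f v * exp (- v) ^ j \<partial>erlang k) =
           (\<integral>v. f (v / real (Suc j)) \<partial>erlang k) / real (Suc j) ^ Suc k"
proof -
  let ?c = "1 / real (Suc j)"
  have "(\<integral>v. f v * exp (- v) ^ j \<partial>erlang k) =
      (\<integral>v. erlang_density k 1 v * (f v * exp (- v) ^ j) \<partial>lborel)"
    by (subst integral_density) auto
  also have "\<dots> = \<bar>?c\<bar> * (\<integral>v. erlang_density k 1 (0 + ?c * v) * (f (0 + ?c * v) * exp (- (0 + ?c * v)) ^ j) \<partial>lborel)"
    by (subst lborel_integral_real_affine[where c = ?c and t = 0]) auto
  also have "\<dots> = (\<integral>v. (erlang_density k 1 v * f (v / real (Suc j))) / real (Suc j) ^ Suc k \<partial>lborel)"
    unfolding integral_mult_right_zero[symmetric]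
  proof (rule Bochner_Integration.integral_cong[OF refl])
    fix v
    have "exp (- (?c * v)) ^ Suc j = exp (real (Suc j) * - (?c * v))"
      by (rule exp_of_nat_mult[symmetric])
    also have "real (Suc j) * - (?c * v) = - v" by (simp del: of_nat_Suc)
    finally have "exp (- (?c * v)) * exp (- (?c * v)) ^ j = exp (- v)" by simp
    then show "\<bar>?c\<bar> * (erlang_density k 1 (0 + ?c * v) * (f (0 + ?c * v) * exp (- (0 + ?c * v)) ^ j)) =
        erlang_density k 1 v * f (v / real (Suc j)) / real (Suc j) ^ Suc k"
      by (simp add: erlang_density_def divide_less_0_iff power_divide power_one_over mult_ac del: of_nat_Suc)
  qed
  also have "\<dots> = (\<integral>v. f (v / real (Suc j)) \<partial>erlang k) / real (Suc j) ^ Suc k"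
    by (subst integral_density) auto
  finally show ?thesis .
qed

lemma erlang_integrable:
  fixes f :: "real \<Rightarrow> real"
  assumes "f \<in> borel_measurable borel" "\<And>v. 0 < v \<Longrightarrow> \<bar>f v\<bar> \<le> B"
  shows "integrable (erlang k) f"
proof -
  interpret E: prob_space "erlang k" by (rule prob_space_erlang_density) auto
  have "AE v in erlang k. norm (f v) \<le> B"
    by (rule eventually_mono[OF AE_erlang_pos]) (use assms(2) in auto)
  then show ?thesis
    by (rule E.integrable_const_bound) (use assms(1) in simp)
qed

lemma erlang_integral_abs_le:
  fixes f :: "real \<Rightarrow> real"
  assumes "f \<in> borel_measurable borel" "\<And>v. 0 < v \<Longrightarrow> \<bar>f v\<bar> \<le> B"
  shows "\<bar>\<integral>v. f v \<partial>erlang k\<bar> \<le> B"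
proof -
  interpret E: prob_space "erlang k" by (rule prob_space_erlang_density) auto
  have "\<bar>\<integral>v. f v \<partial>erlang k\<bar> \<le> (\<integral>v. \<bar>f v\<bar> \<partial>erlang k)"
    by (rule integral_abs_bound)
  also have "\<dots> \<le> (\<integral>v. B \<partial>erlang k)"
    by (rule integral_mono_AE[OF integrable_abs[OF erlang_integrable[OF assms]]])
       (auto intro: eventually_mono[OF AE_erlang_pos] assms(2))
  finally show ?thesis by (simp add: E.prob_space[simplified])
qed

text \<open>Rescaling the argument of \<open>h\<close> by a constant does not affect the limit, so each monomial in
  \<open>exp (- v)\<close> produces its own Gamma average times \<open>G\<close>.\<close>

lemma tauberian_exp_polynomial:
  fixes h p :: "real \<Rightarrow> real"
  assumes [measurable]: "h \<in> borel_measurable borel"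
    and bnd: "\<And>v. 0 < v \<Longrightarrow> \<bar>h v\<bar> \<le> 1"
    and lim: "((\<lambda>x. \<integral>v. h (v * x) \<partial>erlang k) \<longlongrightarrow> G) at_top"
    and p: "real_polynomial_function p"
  shows "((\<lambda>x. \<integral>v. h (v * x) * p (exp (- v)) \<partial>erlang k) \<longlongrightarrow> G * (\<integral>v. p (exp (- v)) \<partial>erlang k)) at_top"
proof -
  interpret E: prob_space "erlang k" by (rule prob_space_erlang_density) auto
  obtain a d where p_eq: "p = (\<lambda>x. \<Sum>i\<le>d. a i * x ^ i)"
    using p unfolding real_polynomial_function_iff_sum by blast
  have one: "(\<integral>v. exp (- v) ^ j \<partial>erlang k) = 1 / real (Suc j) ^ Suc k" for j
    using erlang_integral_exp_weight[of "\<lambda>_. 1" k j] by (simp add: E.prob_space[simplified])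
  have mono: "((\<lambda>x. \<integral>v. h (v * x) * exp (- v) ^ j \<partial>erlang k) \<longlongrightarrow> G * (\<integral>v. exp (- v) ^ j \<partial>erlang k)) at_top" for j
  proof -
    have "((\<lambda>x. \<integral>v. h (v * (x / real (Suc j))) \<partial>erlang k) \<longlongrightarrow> G) at_top"
      by (rule filterlim_compose[OF lim])
         (auto intro!: filterlim_tendsto_pos_mult_at_top[OF tendsto_const[of "1 / real (Suc j)"] _ filterlim_ident, simplified])
    then have "((\<lambda>x. (\<integral>v. h (v * (x / real (Suc j))) \<partial>erlang k) / real (Suc j) ^ Suc k)
        \<longlongrightarrow> G / real (Suc j) ^ Suc k) at_top"
      by (intro tendsto_intros) auto
    moreover have "(\<integral>v. h (v * x) * exp (- v) ^ j \<partial>erlang k) =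
        (\<integral>v. h (v * (x / real (Suc j))) \<partial>erlang k) / real (Suc j) ^ Suc k" for x
      by (subst erlang_integral_exp_weight) (auto simp: mult_ac)
    ultimately show ?thesis by (simp add: one)
  qed
  have int1: "integrable (erlang k) (\<lambda>v. a i * (h (v * x) * exp (- v) ^ i))" if "x > 0" for x i
  proof (rule integrable_mult_right, rule erlang_integrable[where B = 1])
    fix v :: real assume "0 < v"
    then show "\<bar>h (v * x) * exp (- v) ^ i\<bar> \<le> 1"
      using bnd[of "v * x"] that by (auto simp: abs_mult intro!: mult_le_one power_le_one)
  qed measurable
  have int2: "integrable (erlang k) (\<lambda>v. a i * exp (- v) ^ i)" for i
    by (rule integrable_mult_right, rule erlang_integrable[where B = 1]) (auto intro!: power_le_one)
  have "((\<lambda>x. \<Sum>i\<le>d. a i * (\<integral>v. h (v * x) * exp (- v) ^ i \<partial>erlang k)) \<longlongrightarrow>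
      (\<Sum>i\<le>d. a i * (G * (\<integral>v. exp (- v) ^ i \<partial>erlang k)))) at_top"
    by (intro tendsto_intros mono)
  also have "(\<Sum>i\<le>d. a i * (G * (\<integral>v. exp (- v) ^ i \<partial>erlang k))) = G * (\<integral>v. p (exp (- v)) \<partial>erlang k)"
    unfolding p_eq using int2 by (simp add: Bochner_Integration.integral_sum sum_distrib_left mult_ac)
  finally show ?thesis
  proof (rule Lim_transform_eventually)
    show "\<forall>\<^sub>F x in at_top. (\<Sum>i\<le>d. a i * (\<integral>v. h (v * x) * exp (- v) ^ i \<partial>erlang k)) =
        (\<integral>v. h (v * x) * p (exp (- v)) \<partial>erlang k)"
      using eventually_gt_at_top[of 0]
    proof eventually_elim
      case (elim x)
      have "(\<integral>v. h (v * x) * p (exp (- v)) \<partial>erlang k) = (\<integral>v. (\<Sum>i\<le>d. a i * (h (v * x) * exp (- v) ^ i)) \<partial>erlang k)"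
        unfolding p_eq by (simp add: sum_distrib_left mult_ac)
      also have "\<dots> = (\<Sum>i\<le>d. \<integral>v. a i * (h (v * x) * exp (- v) ^ i) \<partial>erlang k)"
        using int1[OF elim] by (rule Bochner_Integration.integral_sum)
      finally show ?case by simp
    qed
  qed
qed

text \<open>Uniform approximation of \<open>q\<close> by polynomials on \<open>[0, 1]\<close>, where \<open>exp (- v)\<close> lies for \<open>v > 0\<close>: since \<open>h\<close> is
  bounded by 1, the error is uniform in \<open>x\<close>.\<close>

lemma tauberian_exp:
  fixes h q :: "real \<Rightarrow> real"
  assumes [measurable]: "h \<in> borel_measurable borel"
    and bnd: "\<And>v. 0 < v \<Longrightarrow> \<bar>h v\<bar> \<le> 1"
    and lim: "((\<lambda>x. \<integral>v. h (v * x) \<partial>erlang k) \<longlongrightarrow> G) at_top"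
    and q: "continuous_on UNIV q"
  shows "((\<lambda>x. \<integral>v. h (v * x) * q (exp (- v)) \<partial>erlang k) \<longlongrightarrow> G * (\<integral>v. q (exp (- v)) \<partial>erlang k)) at_top"
proof (rule tendstoI)
  fix e :: real assume "0 < e"
  \<comment> \<open>the error \<open>d\<close> of the approximation enters three times, once with the factor \<open>\<bar>G\<bar>\<close>\<close>
  define d where "d = e / (2 + \<bar>G\<bar>)"
  have "0 < d" using \<open>0 < e\<close> by (simp add: d_def add_pos_nonneg)
  obtain p where p: "real_polynomial_function p" and close: "\<And>z. z \<in> {0..1} \<Longrightarrow> \<bar>q z - p z\<bar> < d"
    using Stone_Weierstrass_real_polynomial_function[of "{0..1}" q d] q \<open>0 < d\<close>
    by (metis compact_Icc continuous_on_subset subset_UNIV)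
  have [measurable]: "q \<in> borel_measurable borel" using q by (rule borel_measurable_continuous_onI)
  have [measurable]: "p \<in> borel_measurable borel"
    using p by (intro borel_measurable_continuous_onI continuous_on_polymonial_function)
      (simp add: real_polynomial_function_eq)
  have close': "\<bar>q (exp (- v)) - p (exp (- v))\<bar> \<le> d" if "0 < v" for v :: real
    using close[of "exp (- v)"] that by auto
  obtain B where B: "\<bar>q z\<bar> \<le> B" if "z \<in> {0..1}" for z
    using compact_imp_bounded[OF compact_continuous_image[OF continuous_on_subset[OF q] compact_Icc, of 0 1]]
    unfolding bounded_iff by force
  have qB: "\<bar>q (exp (- v))\<bar> \<le> B" "\<bar>p (exp (- v))\<bar> \<le> B + d" if "0 < v" for v :: real
    using B[of "exp (- v)"] close'[OF that] that by auto
  have E2: "\<bar>(\<integral>v. q (exp (- v)) \<partial>erlang k) - (\<integral>v. p (exp (- v)) \<partial>erlang k)\<bar> \<le> d"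
    using qB close' erlang_integrable[of "\<lambda>v. q (exp (- v))" B] erlang_integrable[of "\<lambda>v. p (exp (- v))" "B + d"]
      erlang_integral_abs_le[of "\<lambda>v. q (exp (- v)) - p (exp (- v))" d]
    by (simp add: Bochner_Integration.integral_diff)
  have "\<forall>\<^sub>F x in at_top. dist (\<integral>v. h (v * x) * p (exp (- v)) \<partial>erlang k) (G * (\<integral>v. p (exp (- v)) \<partial>erlang k)) < d"
    using tauberian_exp_polynomial[OF assms(1) bnd lim p] \<open>0 < d\<close> by (rule tendstoD)
  then show "\<forall>\<^sub>F x in at_top. dist (\<integral>v. h (v * x) * q (exp (- v)) \<partial>erlang k) (G * (\<integral>v. q (exp (- v)) \<partial>erlang k)) < e"
    using eventually_gt_at_top[of 0]
  proof eventually_elim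
    case (elim x)
    let ?q = "\<lambda>v. h (v * x) * q (exp (- v))" and ?p = "\<lambda>v. h (v * x) * p (exp (- v))"
    have h: "\<bar>h (v * x)\<bar> \<le> 1" if "0 < v" for v using bnd[of "v * x"] that elim by simp
    have "\<bar>?q v\<bar> \<le> 1 * B" "\<bar>?p v\<bar> \<le> 1 * (B + d)" if "0 < v" for v
      unfolding abs_mult using h[OF that] qB[OF that] by (intro mult_mono; simp)+
    then have "integrable (erlang k) ?q" "integrable (erlang k) ?p"
      by (intro erlang_integrable[where B = "1 * B"] erlang_integrable[where B = "1 * (B + d)"]; simp)+
    then have "(\<integral>v. ?q v \<partial>erlang k) - (\<integral>v. ?p v \<partial>erlang k) = (\<integral>v. h (v * x) * (q (exp (- v)) - p (exp (- v))) \<partial>erlang k)"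
      by (simp add: right_diff_distrib)
    also have "\<bar>\<dots>\<bar> \<le> 1 * d"
    proof (rule erlang_integral_abs_le)
      show "\<bar>h (v * x) * (q (exp (- v)) - p (exp (- v)))\<bar> \<le> 1 * d" if "0 < v" for v
        unfolding abs_mult using h[OF that] close'[OF that] by (intro mult_mono) auto
    qed measurable
    finally have E1: "\<bar>(\<integral>v. ?q v \<partial>erlang k) - (\<integral>v. ?p v \<partial>erlang k)\<bar> \<le> d" by simp
    have E3: "\<bar>G * (\<integral>v. q (exp (- v)) \<partial>erlang k) - G * (\<integral>v. p (exp (- v)) \<partial>erlang k)\<bar> \<le> \<bar>G\<bar> * d"
      using E2 by (simp add: abs_mult mult_left_mono flip: right_diff_distrib)
    have "(2 + \<bar>G\<bar>) * d = e" using \<open>0 < e\<close> by (simp add: d_def add_pos_nonneg)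
    then have "d + d + \<bar>G\<bar> * d = e" by (simp add: algebra_simps)
    then show ?case using E1 E3 elim unfolding dist_real_def by linarith
  qed
qed


text \<open>As a function of \<open>v\<close>, the weight \<open>q (exp (- v))\<close> is a bump supported on \<open>(a, b)\<close>.\<close>

lemma bump_integral_pos:
  fixes a b :: real
  assumes "0 < a" "a < b"
  defines "q \<equiv> \<lambda>z. max 0 (min (z - exp (- b)) (exp (- a) - z))"
  shows "0 < (\<integral>v. q (exp (- v)) \<partial>erlang k)"
proof -
  have [measurable]: "q \<in> borel_measurable borel" unfolding q_def by measurable
  have q0: "0 \<le> q z" for z by (simp add: q_def)
  have q_pos: "0 < q (exp (- v))" if "a < v" "v < b" for v using that by (simp add: q_def)
  have int: "integrable (erlang k) (\<lambda>v. q (exp (- v)))"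
    by (rule erlang_integrable[where B = 2]) (auto simp: q_def abs_if max_def min_def, (smt (verit) assms exp_gt_zero exp_le_one_iff)+)
  have "(\<integral>v. q (exp (- v)) \<partial>erlang k) \<noteq> 0"
  proof
    assume "(\<integral>v. q (exp (- v)) \<partial>erlang k) = 0"
    then have "AE v in erlang k. q (exp (- v)) = 0"
      using integral_nonneg_eq_0_iff_AE[OF int] q0 by auto
    then have "AE v in lborel. 0 < erlang_density k 1 v \<longrightarrow> q (exp (- v)) = 0"
      by (subst (asm) AE_density) auto
    then have "AE v in lborel. v \<notin> {a<..<b}"
    proof eventually_elim
      case (elim v)
      show ?case
      proof
        assume v: "v \<in> {a<..<b}"
        then have "0 < erlang_density k 1 v" using assms(1) by (simp add: erlang_density_def)
        with elim q_pos[of v] v show False by simp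
      qed
    qed
    then have "emeasure lborel {a<..<b} = 0"
      by (subst (asm) AE_iff_measurable[of "{a<..<b}"]) auto
    then show False using assms(2) by simp
  qed
  moreover have "0 \<le> (\<integral>v. q (exp (- v)) \<partial>erlang k)" using q0 by simp
  ultimately show ?thesis by linarith
qed

text \<open>With a bump supported on \<open>(1, 1 + e)\<close> as weight, only arguments between \<open>x\<close> and \<open>(1 + e) x\<close>
  contribute, and there \<open>g v / v\<close> lies between \<open>g x / ((1 + e) x)\<close> and \<open>g ((1 + e) x) / x\<close>. The
  truncation at 1 keeps the upper bound in the domain where \<open>binomial_tail\<close> is increasing.\<close>

lemma tauberian_monotone_ratio:
  fixes g :: "real \<Rightarrow> real"
  assumes [measurable]: "g \<in> borel_measurable borel"
    and mono: "\<And>v w. 0 < v \<Longrightarrow> v \<le> w \<Longrightarrow> g v \<le> g w"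
    and nonneg: "\<And>v. 0 < v \<Longrightarrow> 0 \<le> g v" and le: "\<And>v. 0 < v \<Longrightarrow> g v \<le> v"
    and r: "1 \<le> r" "r \<le> k"
    and lim: "((\<lambda>x. \<integral>v. binomial_tail k r (g (v * x) / (v * x)) \<partial>erlang k) \<longlongrightarrow> G) at_top"
    and e: "0 < e"
  shows "G < c \<Longrightarrow> \<forall>\<^sub>F x in at_top. binomial_tail k r (g x / ((1 + e) * x)) < c"
    and "c < G \<Longrightarrow> \<forall>\<^sub>F x in at_top. c < binomial_tail k r (min 1 (g ((1 + e) * x) / x))"
proof -
  let ?\<phi> = "binomial_tail k r"
  have [measurable]: "?\<phi> \<in> borel_measurable borel"
    unfolding binomial_tail_def by measurable
  define q where "q = (\<lambda>z::real. max 0 (min (z - exp (- (1 + e))) (exp (- 1) - z)))"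
  have [measurable]: "q \<in> borel_measurable borel" unfolding q_def by measurable
  have q0: "0 \<le> q z" for z by (simp add: q_def)
  have q_pos: "q (exp (- v)) = 0" if "\<not> (1 < v \<and> v < 1 + e)" for v
  proof -
    have "\<not> (exp (- (1 + e)) < exp (- v) \<and> exp (- v) < exp (- 1))"
      using that unfolding exp_less_cancel_iff by linarith
    then show ?thesis unfolding q_def by linarith
  qed
  have q_bound: "\<bar>q (exp (- v))\<bar> \<le> 1" for v
  proof -
    have "exp (- 1 :: real) \<le> 1" by simp
    then show ?thesis unfolding q_def using exp_gt_zero[of "- v"] by linarith
  qed
  define K where "K = (\<integral>v. q (exp (- v)) \<partial>erlang k)"
  have K: "0 < K" using bump_integral_pos[of 1 "1 + e" k] e by (simp add: K_def q_def)
  define A where "A x = (\<integral>v. ?\<phi> (g (v * x) / (v * x)) * q (exp (- v)) \<partial>erlang k)" for x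
  have ratio: "0 \<le> g v / v" "g v / v \<le> 1" if "0 < v" for v
    using nonneg[OF that] le[OF that] that by auto
  have \<phi>_bound: "0 \<le> ?\<phi> (g v / v)" "?\<phi> (g v / v) \<le> 1" if "0 < v" for v
    using binomial_tail_bounds[OF r ratio[OF that]] by auto
  have A_lim: "(A \<longlongrightarrow> G * K) at_top"
    unfolding A_def K_def
  proof (rule tauberian_exp[where h = "\<lambda>v. ?\<phi> (g v / v)", OF _ _ lim])
    show "continuous_on UNIV q" unfolding q_def by (intro continuous_intros)
  qed (use \<phi>_bound in auto)
  have int: "integrable (erlang k) (\<lambda>v. c * q (exp (- v)))" for c
    by (intro integrable_mult_right erlang_integrable[where B = 1] q_bound) measurable
  have intA: "integrable (erlang k) (\<lambda>v. ?\<phi> (g (v * x) / (v * x)) * q (exp (- v)))" if "0 < x" for x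
  proof (rule erlang_integrable[where B = 1])
    fix v :: real assume "0 < v"
    then show "\<bar>?\<phi> (g (v * x) / (v * x)) * q (exp (- v))\<bar> \<le> 1"
      using \<phi>_bound[of "v * x"] q_bound[of v] that by (auto simp: abs_mult intro!: mult_le_one)
  qed measurable
  have K_eq: "c * K = (\<integral>v. c * q (exp (- v)) \<partial>erlang k)" for c by (simp add: K_def)
  show "\<forall>\<^sub>F x in at_top. ?\<phi> (g x / ((1 + e) * x)) < c" if "G < c"
  proof -
    have "\<forall>\<^sub>F x in at_top. A x < c * K"
      using A_lim by (rule order_tendstoD) (use that K in simp)
    then show ?thesis using eventually_gt_at_top[of 0]
    proof eventually_elim
      case (elim x)
      have "?\<phi> (g x / ((1 + e) * x)) * K \<le> A x"
        unfolding K_eq A_def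
      proof (rule integral_mono[OF int intA[OF elim(2)]])
        fix v
        show "?\<phi> (g x / ((1 + e) * x)) * q (exp (- v)) \<le> ?\<phi> (g (v * x) / (v * x)) * q (exp (- v))"
        proof (cases "1 < v \<and> v < 1 + e")
          case True
          then have v: "0 < v * x" "x \<le> v * x" "v * x \<le> (1 + e) * x" using elim by auto
          have "g x / ((1 + e) * x) \<le> g (v * x) / (v * x)"
            using v elim e mono[of x "v * x"] nonneg[of "v * x"] nonneg[of x] by (intro frac_le) auto
          then have "?\<phi> (g x / ((1 + e) * x)) \<le> ?\<phi> (g (v * x) / (v * x))"
            using ratio[OF v(1)] nonneg[of x] elim e by (intro binomial_tail_mono r) auto
          then show ?thesis using q0 by (rule mult_right_mono)
        qed (simp add: q_pos)
      qed
      then have "?\<phi> (g x / ((1 + e) * x)) * K < c * K" using elim by linarith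
      then show ?case using K by simp
    qed
  qed
  show "\<forall>\<^sub>F x in at_top. c < ?\<phi> (min 1 (g ((1 + e) * x) / x))" if "c < G"
  proof -
    have "\<forall>\<^sub>F x in at_top. c * K < A x"
      using A_lim by (rule order_tendstoD) (use that K in simp)
    then show ?thesis using eventually_gt_at_top[of 0]
    proof eventually_elim
      case (elim x)
      have "A x \<le> ?\<phi> (min 1 (g ((1 + e) * x) / x)) * K"
        unfolding K_eq A_def
      proof (rule integral_mono[OF intA[OF elim(2)] int])
        fix v
        show "?\<phi> (g (v * x) / (v * x)) * q (exp (- v)) \<le> ?\<phi> (min 1 (g ((1 + e) * x) / x)) * q (exp (- v))"
        proof (cases "1 < v \<and> v < 1 + e")
          case True
          then have v: "0 < v * x" "x \<le> v * x" "v * x \<le> (1 + e) * x" using elim by auto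
          have "g (v * x) / (v * x) \<le> g ((1 + e) * x) / x"
            using v elim e mono[of "v * x" "(1 + e) * x"] nonneg[of "v * x"] nonneg[of "(1 + e) * x"]
            by (intro frac_le) auto
          then have "?\<phi> (g (v * x) / (v * x)) \<le> ?\<phi> (min 1 (g ((1 + e) * x) / x))"
            using ratio[OF v(1)] by (intro binomial_tail_mono r) auto
          then show ?thesis using q0 by (rule mult_right_mono)
        qed (simp add: q_pos)
      qed
      then have "c * K < ?\<phi> (min 1 (g ((1 + e) * x) / x)) * K" using elim by linarith
      then show ?case using K by simp
    qed
  qed
qed

text \<open>Strict monotonicity of \<open>binomial_tail\<close> turns the bounds of the preceding lemma into bounds for
  \<open>g v / v\<close>; the factor \<open>1 + e\<close> is chosen so close to 1 that it fits between \<open>p\<close> and \<open>u\<close>.\<close>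

lemma tauberian_ratio_limit:
  fixes g :: "real \<Rightarrow> real"
  assumes meas: "g \<in> borel_measurable borel"
    and mono: "\<And>v w. 0 < v \<Longrightarrow> v \<le> w \<Longrightarrow> g v \<le> g w"
    and nonneg: "\<And>v. 0 < v \<Longrightarrow> 0 \<le> g v" and le: "\<And>v. 0 < v \<Longrightarrow> g v \<le> v"
    and r: "1 \<le> r" "r \<le> k"
    and lim: "((\<lambda>x. \<integral>v. binomial_tail k r (g (v * x) / (v * x)) \<partial>erlang k) \<longlongrightarrow> G) at_top"
    and p: "0 \<le> p" "p \<le> 1" "binomial_tail k r p = G"
  shows "((\<lambda>v. g v / v) \<longlongrightarrow> p) at_top"
proof (rule order_tendstoI)
  let ?\<phi> = "binomial_tail k r"
  fix u assume "p < u"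
  show "\<forall>\<^sub>F v in at_top. g v / v < u"
  proof (cases "u \<le> 1")
    case False
    show ?thesis using eventually_gt_at_top[of 0]
    proof eventually_elim
      case (elim v) then show ?case using le[OF elim] False by (simp add: field_simps) (smt (verit) mult_less_cancel_right1)
    qed
  next
    case True
    define p' where "p' = (p + u) / 2"
    have p': "p < p'" "p' < u" "0 < p'" using \<open>p < u\<close> p by (auto simp: p'_def)
    define e where "e = u / p' - 1"
    have e: "0 < e" "(1 + e) * p' = u" using p' by (auto simp: e_def)
    have "G < ?\<phi> p'" using binomial_tail_strict_mono[OF r p(1) p'(1)] p' True p by simp
    then have "\<forall>\<^sub>F x in at_top. ?\<phi> (g x / ((1 + e) * x)) < ?\<phi> p'"
      by (intro tauberian_monotone_ratio(1)[OF meas mono nonneg le r lim e(1)])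
    then show ?thesis using eventually_gt_at_top[of 0]
    proof (eventually_elim)
      case (elim x)
      have "0 \<le> g x / ((1 + e) * x)" "g x / ((1 + e) * x) \<le> 1"
        using nonneg[of x] le[of x] elim e by (auto simp: divide_le_eq algebra_simps intro: add_increasing2)
      then have "g x / ((1 + e) * x) < p'"
        using binomial_tail_mono[OF r, of p' "g x / ((1 + e) * x)"] elim p' by (meson not_le less_imp_le leD)
      then have "(1 + e) * (g x / ((1 + e) * x)) < (1 + e) * p'" using e by (intro mult_strict_left_mono) auto
      then show ?case using e by simp
    qed
  qed
next
  let ?\<phi> = "binomial_tail k r"
  fix u assume "u < p"
  show "\<forall>\<^sub>F v in at_top. u < g v / v"
  proof (cases "u < 0")
    case True
    show ?thesis using eventually_gt_at_top[of 0]
      by eventually_elim (use True nonneg in \<open>auto intro: less_le_trans\<close>)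
  next
    case False
    \<comment> \<open>two intermediate levels, because \<open>u\<close> itself may be 0 and could not serve as a divisor\<close>
    define u' where "u' = (u + p) / 2"
    define p' where "p' = (u' + p) / 2"
    have p': "u < u'" "0 < u'" "u' < p'" "p' < p" using \<open>u < p\<close> False by (auto simp: p'_def u'_def)
    define e where "e = p' / u' - 1"
    have e: "0 < e" "(1 + e) * u' = p'" using p' by (auto simp: e_def)
    have "?\<phi> p' < G" using binomial_tail_strict_mono[OF r _ p'(4)] p' p by simp
    then have "\<forall>\<^sub>F x in at_top. ?\<phi> p' < ?\<phi> (min 1 (g ((1 + e) * x) / x))"
      by (intro tauberian_monotone_ratio(2)[OF meas mono nonneg le r lim e(1)])
    then have "\<forall>\<^sub>F x in at_top. u' < g ((1 + e) * x) / ((1 + e) * x)" using eventually_gt_at_top[of 0]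
    proof (eventually_elim)
      case (elim x)
      have "0 \<le> g ((1 + e) * x) / x" using nonneg[of "(1 + e) * x"] elim e by auto
      then have "p' < min 1 (g ((1 + e) * x) / x)"
        using binomial_tail_mono[OF r, of "min 1 (g ((1 + e) * x) / x)" p'] elim p' p
        by (meson not_le min.cobounded1 min.boundedI zero_le_one less_imp_le leD order_trans)
      then have "(1 + e) * u' < g ((1 + e) * x) / x" using e by simp
      then have "u' < g ((1 + e) * x) / x / (1 + e)"
        using e by (subst pos_less_divide_eq) (simp_all add: mult.commute)
      then show ?case by (simp add: mult.commute)
    qed
    then have "\<forall>\<^sub>F x in at_top. u' < g ((1 + e) * (x / (1 + e))) / ((1 + e) * (x / (1 + e)))"
      by (rule eventually_compose_filterlim)
         (use e filterlim_tendsto_pos_mult_at_top[OF tendsto_const[of "1 / (1 + e)"] _ filterlim_ident] in simp)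
    then show ?thesis
      by eventually_elim (use e p' in auto)
  qed
qed

context tail_measure
begin

lemma tail_at_top: "filterlim (tail \<mu>) at_top (at_right 0)"
  unfolding filterlim_at_top_dense
proof
  fix Z
  obtain x where "x > 0" "Z < tail \<mu> x" using tail_unbounded by blast
  then show "\<forall>\<^sub>F x in at_right 0. Z < tail \<mu> x"
    unfolding eventually_at_right_field using tail_antimono[of _ x] by (metis less_imp_le less_le_trans)
qed

lemma tail_inv_tail_le: "0 < x \<Longrightarrow> tail_inv (tail \<mu> x) \<le> x"
  using tail_inv_le_iff[OF tail_pos] by blast

text \<open>If the measure has no mass just to the left of \<open>x\<close>, then \<open>tail_inv (tail \<mu> x)\<close> is smaller than
  \<open>x\<close>, which still gives the upper bound. For the
  lower bound, the inverse at the slightly smaller level \<open>(1 - e) * tail \<mu> x\<close> exceeds \<open>x\<close>.\<close>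

lemma tail_ratio_limit:
  assumes "0 < l" "0 \<le> p"
    and lim: "((\<lambda>v. tail \<mu> (l * tail_inv v) / v) \<longlongrightarrow> p) at_top"
  shows "((\<lambda>x. tail \<mu> (l * x) / tail \<mu> x) \<longlongrightarrow> p) (at_right 0)"
proof (rule order_tendstoI)
  let ?g = "\<lambda>v. tail \<mu> (l * tail_inv v)"
  have pos: "\<forall>\<^sub>F x in at_right (0::real). 0 < x" by (simp add: eventually_at_right_less)
  fix c assume "p < c"
  have "\<forall>\<^sub>F x in at_right 0. ?g (tail \<mu> x) / tail \<mu> x < c"
    by (rule eventually_compose_filterlim[OF order_tendstoD(2)[OF lim \<open>p < c\<close>] tail_at_top])
  then show "\<forall>\<^sub>F x in at_right 0. tail \<mu> (l * x) / tail \<mu> x < c"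
    using pos
  proof eventually_elim
    case (elim x)
    have "tail \<mu> (l * x) \<le> ?g (tail \<mu> x)"
      using assms(1) tail_inv_tail_le[OF elim(2)] tail_inv_pos[OF tail_pos[OF elim(2)]]
      by (intro tail_antimono) auto
    then have "tail \<mu> (l * x) / tail \<mu> x \<le> ?g (tail \<mu> x) / tail \<mu> x"
      using tail_pos[OF elim(2)] by (intro divide_right_mono) auto
    then show ?case using elim by linarith
  qed
next
  let ?g = "\<lambda>v. tail \<mu> (l * tail_inv v)"
  have pos: "\<forall>\<^sub>F x in at_right (0::real). 0 < x" by (simp add: eventually_at_right_less)
  fix c assume "c < p"
  have "((\<lambda>e. (1 - e) * p) \<longlongrightarrow> (1 - 0) * p) (at_right (0::real))" by (intro tendsto_intros)
  then have "\<forall>\<^sub>F e in at_right (0::real). c < (1 - e) * p"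
    by (rule order_tendstoD) (use \<open>c < p\<close> in simp)
  then have "\<forall>\<^sub>F e in at_right (0::real). c < (1 - e) * p \<and> 0 < e \<and> e < 1"
    using eventually_at_right_real[of 0 "1::real"] by (auto elim: eventually_elim2)
  then obtain e where e: "c < (1 - e) * p" "0 < e" "e < 1"
    using eventually_happens'[of "at_right (0::real)"] by force
  have lim': "((\<lambda>v. (1 - e) * (?g v / v)) \<longlongrightarrow> (1 - e) * p) at_top"
    by (intro tendsto_intros lim)
  have "filterlim (\<lambda>x. (1 - e) * tail \<mu> x) at_top (at_right 0)"
    by (rule filterlim_tendsto_pos_mult_at_top[OF tendsto_const _ tail_at_top]) (use e in simp)
  from eventually_compose_filterlim[OF order_tendstoD(1)[OF lim' e(1)] this]
  show "\<forall>\<^sub>F x in at_right 0. c < tail \<mu> (l * x) / tail \<mu> x"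
    using pos
  proof eventually_elim
    case (elim x)
    let ?u = "(1 - e) * tail \<mu> x"
    have u: "0 < ?u" "?u < tail \<mu> x" using tail_pos[OF elim(2)] e by auto
    have "x < tail_inv ?u" using tail_inv_le_iff[OF u(1) elim(2)] u(2) by linarith
    then have "?g ?u \<le> tail \<mu> (l * x)"
      using assms(1) elim(2) by (intro tail_antimono) auto
    then have "?g ?u / tail \<mu> x \<le> tail \<mu> (l * x) / tail \<mu> x"
      using tail_pos[OF elim(2)] by (intro divide_right_mono) auto
    moreover have "(1 - e) * (?g ?u / ?u) = ?g ?u / tail \<mu> x" using e by simp
    ultimately show ?case using elim by linarith
  qed
qed

end


section \<open>Convergence of tail probabilities\<close>

text \<open>A continuous function between the indicators of \<open>[b, \<infinity>]\<close> and \<open>(a, \<infinity>]\<close>. Truncation happens before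
  the conversion to a real number, so that the infinite values are not lost.\<close>

definition ramp :: "real \<Rightarrow> real \<Rightarrow> ereal \<Rightarrow> real" where
  "ramp a b y = (real_of_ereal (min (ereal b) (max (ereal a) y)) - a) / (b - a)"

lemma ramp_props:
  assumes "a < b"
  shows "0 \<le> ramp a b y" "ramp a b y \<le> 1"
    and "y \<le> ereal a \<Longrightarrow> ramp a b y = 0" "ereal b \<le> y \<Longrightarrow> ramp a b y = 1"
  using assms by (cases y; auto simp: ramp_def min_def max_def)+

lemma continuous_on_ramp: "continuous_on UNIV (ramp a b)"
proof -
  have "continuous_on UNIV (real_of_ereal \<circ> (\<lambda>y. min (ereal b) (max (ereal a) y)))"
  proof (rule continuous_on_compose)
    show "continuous_on UNIV (\<lambda>y. min (ereal b) (max (ereal a) y))"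
      by (intro continuous_intros)
    have "continuous_on (UNIV - {\<infinity>, -\<infinity>}) real_of_ereal"
      by (rule continuous_on_real)
    then show "continuous_on (range (\<lambda>y. min (ereal b) (max (ereal a) y))) real_of_ereal"
      by (rule continuous_on_subset) (auto simp: min_def max_def split: if_splits)
  qed
  then show ?thesis
    unfolding ramp_def[abs_def] o_def divide_inverse by (intro continuous_intros)
qed

lemma borel_measurable_ramp [measurable]: "ramp a b \<in> borel_measurable borel"
  by (intro borel_measurable_continuous_onI continuous_on_ramp)

lemma prob_le_ramp_le_prob:
  assumes "prob_space M" and [measurable]: "X \<in> borel_measurable M" and "a < b"
  shows "measure M {\<omega> \<in> space M. ereal b \<le> X \<omega>} \<le> (\<integral>\<omega>. ramp a b (X \<omega>) \<partial>M)"
    and "(\<integral>\<omega>. ramp a b (X \<omega>) \<partial>M) \<le> measure M {\<omega> \<in> space M. ereal a < X \<omega>}"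
proof -
  interpret prob_space M by fact
  have int: "integrable M (\<lambda>\<omega>. ramp a b (X \<omega>))"
    using ramp_props(1,2)[OF assms(3)] by (intro integrable_const_bound[of _ 1]) auto
  have eq: "measure M A = (\<integral>\<omega>. indicator A \<omega> \<partial>M)" if "A \<in> sets M" for A
    using that by simp
  have intI: "integrable M (indicator A :: _ \<Rightarrow> real)" if "A \<in> sets M" for A
    using that by (simp add: emeasure_eq_measure)
  show "measure M {\<omega> \<in> space M. ereal b \<le> X \<omega>} \<le> (\<integral>\<omega>. ramp a b (X \<omega>) \<partial>M)"
    by (subst eq, measurable, rule integral_mono[OF intI int])
       (auto split: split_indicator simp: ramp_props[OF assms(3)])
  show "(\<integral>\<omega>. ramp a b (X \<omega>) \<partial>M) \<le> measure M {\<omega> \<in> space M. ereal a < X \<omega>}"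
    by (subst eq, measurable, rule integral_mono[OF int intI])
       (auto split: split_indicator simp: ramp_props[OF assms(3)] not_less)
qed

lemma converges_in_distribution_on_ramp:
  assumes "converges_in_distribution_on S M X N Y F" "a < b"
  shows "((\<lambda>t. \<integral>\<omega>. ramp a b (X t \<omega>) \<partial>M t) \<longlongrightarrow> (\<integral>\<omega>. ramp a b (Y \<omega>) \<partial>N)) F"
proof -
  have "bounded (ramp a b ` S)"
    using ramp_props(1,2)[OF assms(2)] by (intro boundedI[of _ 1]) auto
  then show ?thesis
    using assms(1) continuous_on_subset[OF continuous_on_ramp, of S a b] borel_measurable_ramp[of a b]
    unfolding converges_in_distribution_on_def by blast
qed

text \<open>The ramps from \<open>l\<close> to a level slightly above it bound the tail probabilities from below, the ramps to
  \<open>l\<close> from slightly below bound them from above. The two bounds meet because \<open>l\<close> is not an atom of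
  \<open>Y\<close>.\<close>

lemma converges_in_distribution_on_tail_prob:
  fixes X :: "'t \<Rightarrow> 'a \<Rightarrow> ereal" and Y :: "'b \<Rightarrow> ereal"
  assumes conv: "converges_in_distribution_on S M X N Y F"
    and X: "\<forall>\<^sub>F t in F. prob_space (M t) \<and> X t \<in> borel_measurable (M t)"
    and N: "prob_space N" and [measurable]: "Y \<in> borel_measurable N"
    and null: "measure N {\<omega> \<in> space N. Y \<omega> = ereal l} = 0"
  shows "((\<lambda>t. measure (M t) {\<omega> \<in> space (M t). ereal l < X t \<omega>}) \<longlongrightarrow>
           measure N {\<omega> \<in> space N. ereal l < Y \<omega>}) F"
proof (rule order_tendstoI)
  interpret N: prob_space N by fact
  note ramp = converges_in_distribution_on_ramp[OF conv]
  fix c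
  assume c: "c < measure N {\<omega> \<in> space N. ereal l < Y \<omega>}"
  have "(\<lambda>i. N.prob {\<omega> \<in> space N. ereal (l + 1 / real (Suc i)) \<le> Y \<omega>}) \<longlonglongrightarrow>
      N.prob (\<Union>i. {\<omega> \<in> space N. ereal (l + 1 / real (Suc i)) \<le> Y \<omega>})"
  proof (rule N.finite_Lim_measure_incseq)
    show "incseq (\<lambda>i. {\<omega> \<in> space N. ereal (l + 1 / real (Suc i)) \<le> Y \<omega>})"
    proof (rule incseq_SucI, safe)
      fix i \<omega> assume "ereal (l + 1 / real (Suc i)) \<le> Y \<omega>"
      moreover have "ereal (l + 1 / real (Suc (Suc i))) \<le> ereal (l + 1 / real (Suc i))"
        by (simp add: frac_le)
      ultimately show "ereal (l + 1 / real (Suc (Suc i))) \<le> Y \<omega>" by (rule order_trans[rotated])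
    qed
  qed auto
  also have "(\<Union>i. {\<omega> \<in> space N. ereal (l + 1 / real (Suc i)) \<le> Y \<omega>}) = {\<omega> \<in> space N. ereal l < Y \<omega>}"
  proof -
    have "(\<exists>i. ereal (l + 1 / real (Suc i)) \<le> y) \<longleftrightarrow> ereal l < y" for y
    proof
      assume "\<exists>i. ereal (l + 1 / real (Suc i)) \<le> y"
      then obtain i where "ereal (l + 1 / real (Suc i)) \<le> y" ..
      moreover have "ereal l < ereal (l + 1 / real (Suc i))" by simp
      ultimately show "ereal l < y" by (rule less_le_trans[rotated])
    next
      assume "ereal l < y"
      then obtain z where z: "l < z" "ereal z < y"
        using ereal_dense2 by (metis ereal_less(2) less_ereal.simps(1))
      then obtain i where "1 / real (Suc i) < z - l"
        using reals_Archimedean[of "z - l"] by (auto simp: inverse_eq_divide)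
      then have "ereal (l + 1 / real (Suc i)) \<le> ereal z" by simp
      then show "\<exists>i. ereal (l + 1 / real (Suc i)) \<le> y" using z by (meson less_imp_le order_trans)
    qed
    then show ?thesis by auto
  qed
  finally have "\<forall>\<^sub>F i in sequentially. c < N.prob {\<omega> \<in> space N. ereal (l + 1 / real (Suc i)) \<le> Y \<omega>}"
    using c by (rule order_tendstoD)
  then obtain i where i: "c < N.prob {\<omega> \<in> space N. ereal (l + 1 / real (Suc i)) \<le> Y \<omega>}"
    by (auto simp: eventually_sequentially)
  let ?b = "l + 1 / real (Suc i)"
  have lb: "l < ?b" by simp
  have "c < (\<integral>\<omega>. ramp l ?b (Y \<omega>) \<partial>N)"
    using i prob_le_ramp_le_prob(1)[OF N _ lb, of Y] by simp
  from order_tendstoD(1)[OF ramp[OF lb] this] X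
  show "\<forall>\<^sub>F t in F. c < measure (M t) {\<omega> \<in> space (M t). ereal l < X t \<omega>}"
    by eventually_elim (use prob_le_ramp_le_prob(2)[OF _ _ lb] in \<open>fastforce intro: less_le_trans\<close>)
next
  interpret N: prob_space N by fact
  note ramp = converges_in_distribution_on_ramp[OF conv]
  fix c
  assume c: "measure N {\<omega> \<in> space N. ereal l < Y \<omega>} < c"
  have "(\<lambda>i. N.prob {\<omega> \<in> space N. ereal (l - 1 / real (Suc i)) < Y \<omega>}) \<longlonglongrightarrow>
      N.prob (\<Inter>i. {\<omega> \<in> space N. ereal (l - 1 / real (Suc i)) < Y \<omega>})"
  proof (rule N.finite_Lim_measure_decseq)
    show "decseq (\<lambda>i. {\<omega> \<in> space N. ereal (l - 1 / real (Suc i)) < Y \<omega>})"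
    proof (rule decseq_SucI, safe)
      fix i \<omega> assume "ereal (l - 1 / real (Suc (Suc i))) < Y \<omega>"
      moreover have "ereal (l - 1 / real (Suc i)) \<le> ereal (l - 1 / real (Suc (Suc i)))"
        by (simp add: frac_le)
      ultimately show "ereal (l - 1 / real (Suc i)) < Y \<omega>" by (rule le_less_trans[rotated])
    qed
  qed auto
  also have "(\<Inter>i. {\<omega> \<in> space N. ereal (l - 1 / real (Suc i)) < Y \<omega>}) = {\<omega> \<in> space N. ereal l \<le> Y \<omega>}"
  proof -
    have "(\<forall>i. ereal (l - 1 / real (Suc i)) < y) \<longleftrightarrow> ereal l \<le> y" for y
    proof
      assume "ereal l \<le> y"
      moreover have "ereal (l - 1 / real (Suc i)) < ereal l" for i by simp
      ultimately show "\<forall>i. ereal (l - 1 / real (Suc i)) < y" by (blast intro: less_le_trans)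
    next
      assume *: "\<forall>i. ereal (l - 1 / real (Suc i)) < y"
      show "ereal l \<le> y"
      proof (rule ccontr)
        assume "\<not> ereal l \<le> y"
        then obtain z where z: "y < ereal z" "z < l"
          using ereal_dense2 by (metis not_le less_ereal.simps(1))
        then obtain i where "1 / real (Suc i) < l - z"
          using reals_Archimedean[of "l - z"] by (auto simp: inverse_eq_divide)
        then have "ereal z \<le> ereal (l - 1 / real (Suc i))" by simp
        then show False using z * by (meson le_less_trans less_asym' order_less_irrefl less_trans)
      qed
    qed
    then show ?thesis by auto
  qed
  also have "N.prob {\<omega> \<in> space N. ereal l \<le> Y \<omega>} = N.prob {\<omega> \<in> space N. ereal l < Y \<omega>}"
  proof -
    have "{\<omega> \<in> space N. ereal l \<le> Y \<omega>} = {\<omega> \<in> space N. ereal l < Y \<omega>} \<union> {\<omega> \<in> space N. Y \<omega> = ereal l}"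
      by auto
    also have "N.prob \<dots> = N.prob {\<omega> \<in> space N. ereal l < Y \<omega>} + N.prob {\<omega> \<in> space N. Y \<omega> = ereal l}"
      by (rule N.finite_measure_Union) auto
    finally show ?thesis using null by simp
  qed
  finally have "\<forall>\<^sub>F i in sequentially. N.prob {\<omega> \<in> space N. ereal (l - 1 / real (Suc i)) < Y \<omega>} < c"
    using c by (rule order_tendstoD)
  then obtain i where i: "N.prob {\<omega> \<in> space N. ereal (l - 1 / real (Suc i)) < Y \<omega>} < c"
    by (auto simp: eventually_sequentially)
  let ?a = "l - 1 / real (Suc i)"
  have al: "?a < l" by simp
  have "(\<integral>\<omega>. ramp ?a l (Y \<omega>) \<partial>N) < c"
    using i prob_le_ramp_le_prob(2)[OF N _ al, of Y] by simp
  from order_tendstoD(2)[OF ramp[OF al] this] X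
  show "\<forall>\<^sub>F t in F. measure (M t) {\<omega> \<in> space (M t). ereal l < X t \<omega>} < c"
  proof eventually_elim
    case (elim t)
    then have [measurable]: "X t \<in> borel_measurable (M t)" and "prob_space (M t)" by auto
    interpret prob_space "M t" by fact
    have "measure (M t) {\<omega> \<in> space (M t). ereal l < X t \<omega>} \<le> measure (M t) {\<omega> \<in> space (M t). ereal l \<le> X t \<omega>}"
      by (intro finite_measure_mono) auto
    then show ?case using prob_le_ramp_le_prob(1)[OF \<open>prob_space (M t)\<close> _ al, of "X t"] elim by simp
  qed
qed

lemma countable_atoms:
  fixes Y :: "'b \<Rightarrow> ereal"
  assumes "prob_space N" and [measurable]: "Y \<in> borel_measurable N"
  shows "countable {l. measure N {\<omega> \<in> space N. Y \<omega> = ereal l} \<noteq> 0}"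
proof -
  interpret N: prob_space N by fact
  interpret D: prob_space "distr N borel Y" by (rule N.prob_space_distr) measurable
  have "{l. measure N {\<omega> \<in> space N. Y \<omega> = ereal l} \<noteq> 0} \<subseteq> real_of_ereal ` {y. measure (distr N borel Y) {y} \<noteq> 0}"
  proof safe
    fix l assume "measure N {\<omega> \<in> space N. Y \<omega> = ereal l} \<noteq> 0"
    moreover have "Y -` {ereal l} \<inter> space N = {\<omega> \<in> space N. Y \<omega> = ereal l}" by auto
    ultimately have "measure (distr N borel Y) {ereal l} \<noteq> 0" by (simp add: measure_distr)
    then show "l \<in> real_of_ereal ` {y. measure (distr N borel Y) {y} \<noteq> 0}"
      by (intro image_eqI[of _ _ "ereal l"]) auto
  qed
  then show ?thesis
    using D.countable_support by (meson countable_image countable_subset)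
qed

section \<open>Limits of ratios and regular variation\<close>

text \<open>The graph is trapped by the integers: \<open>n * x\<close> lies between two consecutive integers, hence
  \<open>n * h x\<close> lies between two consecutive multiples of \<open>h 1\<close>.\<close>

lemma monotone_additive_linear:
  fixes h :: "real \<Rightarrow> real"
  assumes add: "\<And>x y. h (x + y) = h x + h y" and mono: "\<And>x y. x \<le> y \<Longrightarrow> h x \<le> h y"
  shows "h x = x * h 1"
proof -
  have h0: "h 0 = 0" using add[of 0 0] by simp
  have h_nat: "h (real n * x) = real n * h x" for n x
    by (induction n) (simp_all add: h0 distrib_right add)
  have h_neg: "h (- x) = - h x" for x using add[of x "- x"] h0 by simp
  have h_int: "h (of_int m) = of_int m * h 1" for m
    by (cases m rule: int_cases2) (use h_nat[of _ 1] h_neg in auto)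
  have "\<bar>h x - x * h 1\<bar> \<le> h 1 / real (Suc n)" for n
  proof -
    let ?m = "\<lfloor>real (Suc n) * x\<rfloor>"
    have m: "of_int ?m \<le> real (Suc n) * x" "real (Suc n) * x \<le> of_int (?m + 1)"
      by linarith+
    have "of_int ?m * h 1 \<le> real (Suc n) * h x" "real (Suc n) * h x \<le> of_int (?m + 1) * h 1"
      using mono[OF m(1)] mono[OF m(2)] by (simp_all only: h_int h_nat)
    moreover have "0 \<le> h 1" using mono[of 0 1] h0 by simp
    then have "of_int ?m * h 1 \<le> real (Suc n) * x * h 1" "real (Suc n) * x * h 1 \<le> of_int (?m + 1) * h 1"
      using m by (intro mult_right_mono; simp)+
    ultimately have "\<bar>real (Suc n) * h x - real (Suc n) * x * h 1\<bar> \<le> h 1"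
      by (simp add: distrib_right abs_le_iff)
    then have "real (Suc n) * \<bar>h x - x * h 1\<bar> \<le> h 1"
      by (simp add: abs_mult[symmetric] right_diff_distrib mult.assoc del: of_nat_Suc)
        (metis abs_mult abs_of_nat right_diff_distrib)
    then show ?thesis by (simp add: pos_le_divide_eq mult.commute del: of_nat_Suc)
  qed
  moreover have "(\<lambda>n. h 1 / real (Suc n)) \<longlonglongrightarrow> 0"
    by (intro LIMSEQ_Suc lim_const_over_n)
  ultimately have "\<bar>h x - x * h 1\<bar> \<le> 0" by (intro LIMSEQ_le_const) auto
  then show ?thesis by simp
qed


definition ratio_limit :: "(real \<Rightarrow> real) \<Rightarrow> real \<Rightarrow> real \<Rightarrow> bool" where
  "ratio_limit f l p \<longleftrightarrow> ((\<lambda>x. f (l * x) / f x) \<longlongrightarrow> p) (at_right 0)"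

lemma filterlim_scale_at_right_0:
  assumes "0 < (c::real)" shows "filterlim (\<lambda>x. c * x) (at_right 0) (at_right 0)"
proof -
  have "((\<lambda>x. c * x) \<longlongrightarrow> c * 0) (at_right 0)" by (intro tendsto_intros)
  moreover have "\<forall>\<^sub>F x in at_right 0. c * x \<in> {0<..} \<and> c * x \<noteq> 0"
    using eventually_at_right_less[of "0::real"] by eventually_elim (use assms in auto)
  ultimately show ?thesis unfolding filterlim_at by auto
qed

lemma ratio_limit_unique: "ratio_limit f l p \<Longrightarrow> ratio_limit f l q \<Longrightarrow> p = q"
  unfolding ratio_limit_def by (rule tendsto_unique[rotated]) auto

locale positive_antimono =
  fixes f :: "real \<Rightarrow> real"
  assumes pos: "\<And>x. 0 < x \<Longrightarrow> 0 < f x"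
    and antimono: "\<And>x y. 0 < x \<Longrightarrow> x \<le> y \<Longrightarrow> f y \<le> f x"
begin

lemma ratio_limit_1: "ratio_limit f 1 1"
proof -
  have "\<forall>\<^sub>F x in at_right 0. f (1 * x) / f x = 1"
    using eventually_at_right_less[of "0::real"] by eventually_elim (use pos in force)
  then show ?thesis unfolding ratio_limit_def by (rule tendsto_eventually)
qed

lemma ratio_limit_mult:
  assumes "ratio_limit f a p" "ratio_limit f b q" "0 < b"
  shows "ratio_limit f (a * b) (p * q)"
proof -
  have "((\<lambda>x. f (a * (b * x)) / f (b * x)) \<longlongrightarrow> p) (at_right 0)"
    using filterlim_compose[OF assms(1)[unfolded ratio_limit_def] filterlim_scale_at_right_0[OF assms(3)]] .
  then have "((\<lambda>x. f (a * (b * x)) / f (b * x) * (f (b * x) / f x)) \<longlongrightarrow> p * q) (at_right 0)"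
    using assms(2) unfolding ratio_limit_def by (rule tendsto_mult)
  moreover have "\<forall>\<^sub>F x in at_right 0. f (a * (b * x)) / f (b * x) * (f (b * x) / f x) = f (a * b * x) / f x"
    using eventually_at_right_less[of "0::real"]
  proof eventually_elim
    case (elim x)
    then have "f (b * x) \<noteq> 0" using pos[of "b * x"] assms(3) by simp
    then show ?case by (simp add: mult.assoc)
  qed
  ultimately show ?thesis unfolding ratio_limit_def by (rule Lim_transform_eventually)
qed

lemma ratio_limit_inverse:
  assumes "ratio_limit f a p" "0 < a" "p \<noteq> 0"
  shows "ratio_limit f (inverse a) (inverse p)"
proof -
  have "((\<lambda>x. f (a * (inverse a * x)) / f (inverse a * x)) \<longlongrightarrow> p) (at_right 0)"
    using filterlim_compose[OF assms(1)[unfolded ratio_limit_def] filterlim_scale_at_right_0[of "inverse a"]]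
      assms(2) by simp
  then have "((\<lambda>x. inverse (f (a * (inverse a * x)) / f (inverse a * x))) \<longlongrightarrow> inverse p) (at_right 0)"
    by (rule tendsto_inverse) fact
  moreover have "a * (inverse a * x) = x" for x using assms(2) by (simp flip: mult.assoc)
  ultimately show ?thesis by (simp add: ratio_limit_def)
qed

lemma ratio_limit_power:
  assumes "ratio_limit f a p" "0 < a" shows "ratio_limit f (a ^ n) (p ^ n)"
proof (induction n)
  case 0 show ?case using ratio_limit_1 by simp
next
  case (Suc n) show ?case
    using ratio_limit_mult[OF assms(1) Suc] assms(2) by simp
qed

lemma ratio_antimono:
  assumes "0 < x" "0 < a" "a \<le> b"
  shows "f (b * x) / f x \<le> f (a * x) / f x"
proof (rule divide_right_mono)
  show "f (b * x) \<le> f (a * x)" using assms by (intro antimono) auto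
  show "0 \<le> f x" using pos[OF assms(1)] by simp
qed

lemma ratio_limit_antimono:
  assumes "ratio_limit f a p" "ratio_limit f b q" "0 < a" "a \<le> b"
  shows "q \<le> p"
proof -
  have "\<forall>\<^sub>F x in at_right 0. f (b * x) / f x \<le> f (a * x) / f x"
    using eventually_at_right_less[of "0::real"]
    by eventually_elim (rule ratio_antimono, use assms in auto)
  then show ?thesis
    using assms unfolding ratio_limit_def by (intro tendsto_le[OF _ assms(1)[unfolded ratio_limit_def] assms(2)[unfolded ratio_limit_def]]) auto
qed

text \<open>The numbers with a positive ratio limit form a multiplicative group. It contains a co-countable
  subset of \<open>(1, \<infinity>)\<close>, and every positive \<open>l\<close> is a quotient of two elements of such a subset; so the
  group is \<open>(0, \<infinity>)\<close>, and in logarithmic coordinates the limit is a monotone additive function.\<close>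

lemma regularly_varying_if_ratio_limits:
  assumes cnt: "countable ({1<..} - D)" and D: "D \<subseteq> {1<..}"
    and lim: "\<And>l. l \<in> D \<Longrightarrow> ratio_limit f l (p l)" and p: "\<And>l. l \<in> D \<Longrightarrow> 0 < p l"
  obtains \<alpha> where "0 \<le> \<alpha>" "regularly_varying_at_0 f (- \<alpha>)"
proof -
  have "\<exists>q>0. ratio_limit f l q" if "0 < l" for l
  proof -
    \<comment> \<open>outside this countable set of exceptions both \<open>a\<close> and \<open>a * l\<close> belong to \<open>D\<close>\<close>
    let ?B = "({1<..} - D) \<union> (\<lambda>b. b / l) ` ({1<..} - D)"
    have "countable ?B" using cnt by auto
    moreover have "uncountable {max 1 (1 / l)<..<max 1 (1 / l) + 1}"
      by (simp add: uncountable_open_interval)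
    ultimately obtain a where a: "a \<in> {max 1 (1 / l)<..<max 1 (1 / l) + 1}" "a \<notin> ?B"
      by (meson countable_subset subsetI)
    have "1 < a" "1 < a * l" using a(1) that by (auto simp: field_simps)
    have "a \<in> D" using a \<open>1 < a\<close> by auto
    moreover have "a * l \<in> D"
    proof (rule ccontr)
      assume "a * l \<notin> D"
      then have "a \<in> (\<lambda>b. b / l) ` ({1<..} - D)"
        using \<open>1 < a * l\<close> that by (intro image_eqI[of _ _ "a * l"]) auto
      then show False using a by blast
    qed
    ultimately have "ratio_limit f (a * l * inverse a) (p (a * l) * inverse (p a))"
      using p[of a] \<open>1 < a\<close> by (intro ratio_limit_mult ratio_limit_inverse lim) auto
    moreover have "a * l * inverse a = l" using \<open>1 < a\<close> by simp
    ultimately show ?thesis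
      using \<open>1 < a\<close> p[OF \<open>a \<in> D\<close>] p[OF \<open>a * l \<in> D\<close>]
      by (intro exI[of _ "p (a * l) * inverse (p a)"]) simp
  qed
  then obtain \<psi> where \<psi>: "\<And>l. 0 < l \<Longrightarrow> 0 < \<psi> l" "\<And>l. 0 < l \<Longrightarrow> ratio_limit f l (\<psi> l)"
    by metis
  define h where "h x = - ln (\<psi> (exp x))" for x
  have "h (x + y) = h x + h y" for x y
  proof -
    have "\<psi> (exp (x + y)) = \<psi> (exp x) * \<psi> (exp y)"
      using ratio_limit_unique[OF \<psi>(2)[of "exp (x + y)"]] ratio_limit_mult[OF \<psi>(2)[of "exp x"] \<psi>(2)[of "exp y"]]
      by (simp add: exp_add)
    then show ?thesis using \<psi>(1)[of "exp x"] \<psi>(1)[of "exp y"] by (simp add: h_def ln_mult)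
  qed
  moreover have h_mono: "h x \<le> h y" if "x \<le> y" for x y
    using ratio_limit_antimono[OF \<psi>(2)[of "exp x"] \<psi>(2)[of "exp y"]] that \<psi>(1)[of "exp x"] \<psi>(1)[of "exp y"]
    by (simp add: h_def)
  ultimately have h: "h x = x * h 1" for x by (rule monotone_additive_linear)
  have "\<psi> l = l powr (- h 1)" if "0 < l" for l
  proof -
    have "ln (\<psi> l) = - (ln l * h 1)" using h[of "ln l"] that by (simp add: h_def)
    then have "\<psi> l = exp (- (ln l * h 1))" using \<psi>(1)[OF that] by (metis exp_ln)
    then show ?thesis using that by (simp add: powr_def mult.commute)
  qed
  then have "regularly_varying_at_0 f (- h 1)"
    using \<psi>(2) by (auto simp: regularly_varying_at_0_def ratio_limit_def)
  moreover have "0 \<le> h 1" using h_mono[of 0 1] h[of 0] by simp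
  ultimately show ?thesis using that by blast
qed

text \<open>Monotonicity carries the limit 0 from factors arbitrarily close to 1 to all larger ones; factors
  below 1 are handled by passing to reciprocals.\<close>

lemma rapidly_varying_if_ratio_limits_0:
  assumes "\<And>c. 1 < c \<Longrightarrow> \<exists>l. 1 < l \<and> l < c \<and> ratio_limit f l 0"
  shows "rapidly_varying_at_0 f"
proof -
  have zero: "ratio_limit f c 0" if "1 < c" for c
  proof -
    obtain l where l: "1 < l" "l < c" "ratio_limit f l 0" using assms \<open>1 < c\<close> by blast
    show ?thesis unfolding ratio_limit_def
    proof (rule tendsto_sandwich[OF _ _ tendsto_const l(3)[unfolded ratio_limit_def]])
      show "\<forall>\<^sub>F x in at_right 0. 0 \<le> f (c * x) / f x"
        using eventually_at_right_less[of "0::real"]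
      proof eventually_elim
        case (elim x)
        then have "0 < f x" "0 < f (c * x)" using pos that by auto
        then show ?case by simp
      qed
      show "\<forall>\<^sub>F x in at_right 0. f (c * x) / f x \<le> f (l * x) / f x"
        using eventually_at_right_less[of "0::real"]
        by eventually_elim (rule ratio_antimono, use l in auto)
    qed
  qed
  show ?thesis unfolding rapidly_varying_at_0_def
  proof (intro allI impI)
    fix l :: real assume "0 < l"
    consider "1 < l" | "l = 1" | "l < 1" by linarith
    then show "((\<lambda>x. ereal (f (l * x) / f x)) \<longlongrightarrow> (if 1 < l then 0 else if l = 1 then 1 else \<infinity>)) (at_right 0)"
    proof cases
      case 1
      then show ?thesis using zero[OF 1] by (simp add: ratio_limit_def zero_ereal_def)
    next
      case 2
      then show ?thesis using ratio_limit_1 by (simp add: ratio_limit_def one_ereal_def)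
    next
      case 3
      have "((\<lambda>x. f (inverse l * (l * x)) / f (l * x)) \<longlongrightarrow> 0) (at_right 0)"
        using filterlim_compose[OF zero[of "inverse l", unfolded ratio_limit_def] filterlim_scale_at_right_0[OF \<open>0 < l\<close>]]
          3 \<open>0 < l\<close> by (simp add: one_less_inverse)
      moreover have "inverse l * (l * x) = x" for x using \<open>0 < l\<close> by (simp flip: mult.assoc)
      ultimately have "((\<lambda>x. f x / f (l * x)) \<longlongrightarrow> 0) (at_right 0)" by simp
      moreover have "\<forall>\<^sub>F x in at_right 0. 0 < f x / f (l * x)"
        using eventually_at_right_less[of "0::real"]
      proof eventually_elim
        case (elim x)
        then have "0 < f x" "0 < f (l * x)" using pos \<open>0 < l\<close> by auto
        then show ?case by simp
      qed
      ultimately have "filterlim (\<lambda>x. inverse (f x / f (l * x))) at_top (at_right 0)"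
        by (rule filterlim_inverse_at_top)
      then have "filterlim (\<lambda>x. f (l * x) / f x) at_top (at_right 0)" by simp
      then show ?thesis using 3 by (simp add: tendsto_PInfty_eq_at_top)
    qed
  qed
qed

end

section \<open>The ratio of two order statistics for small times\<close>

lemma tail_scale_measure: "0 \<le> t \<Longrightarrow> tail (scale_measure (ennreal t) \<nu>) x = t * tail \<nu> x"
  by (simp add: tail_def measure_def enn2real_mult)

context tail_measure
begin

lemma tail_measure_scale:
  assumes "0 < t" shows "tail_measure (scale_measure (ennreal t) \<mu>)"
proof
  show "0 < emeasure (scale_measure (ennreal t) \<mu>) {x<..} \<and> emeasure (scale_measure (ennreal t) \<mu>) {x<..} < \<infinity>"
    if "0 < x" for x
    using tail_pos[OF that] that assms by (simp add: emeasure_eq_tail ennreal_zero_less_mult_iff ennreal_mult_less_top)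
  show "emeasure (scale_measure (ennreal t) \<mu>) {0<..} = \<infinity>"
    using assms tail_infinite by (simp add: ennreal_mult_top)
qed (simp add: sets_mu)

lemma tail_inv_scale:
  assumes "0 < t" shows "tail_measure.tail_inv (scale_measure (ennreal t) \<mu>) v = tail_inv (v / t)"
proof -
  have "t * y \<le> v \<longleftrightarrow> y \<le> v / t" for y using assms by (simp add: pos_le_divide_eq mult.commute)
  then show ?thesis
    using assms
    by (simp add: tail_measure.tail_inv_def[OF tail_measure_scale[OF assms]] tail_inv_def tail_scale_measure
        zero_less_divide_iff)
qed

end

text \<open>At time \<open>t\<close> the tail is multiplied by \<open>t\<close>, so the argument of its inverse is divided by \<open>t\<close>: the
  integrand of lemma \<open>prob_ratio\<close> becomes one fixed function evaluated at \<open>v / t\<close>.\<close>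

lemma (in tail_measure) ratio_limit_of_tail_prob:
  assumes M: "\<And>t. t > 0 \<Longrightarrow> prob_space (M t)"
    and X: "\<And>t. t > 0 \<Longrightarrow> ordered_ppp (M t) (X t) (scale_measure (ennreal t) \<mu>)"
    and r: "1 \<le> r" "r \<le> k" and l: "1 \<le> l"
    and lim: "((\<lambda>t. measure (M t) {\<omega> \<in> space (M t). l * X t (Suc k) \<omega> < X t r \<omega>}) \<longlongrightarrow> G) (at_right 0)"
    and p: "0 \<le> p" "p \<le> 1" "binomial_tail k r p = G"
  shows "ratio_limit (tail \<mu>) l p"
  unfolding ratio_limit_def
proof (rule tail_ratio_limit)
  let ?g = "\<lambda>v. tail \<mu> (l * tail_inv v)"
  show "((\<lambda>v. ?g v / v) \<longlongrightarrow> p) at_top"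
  proof (rule tauberian_ratio_limit[OF _ _ _ _ r _ p])
    show "?g \<in> borel_measurable borel" by measurable
    show "?g v \<le> ?g w" if "0 < v" "v \<le> w" for v w
      using that l tail_inv_antimono[OF that] tail_inv_pos[of w] by (intro tail_antimono) auto
    show "0 \<le> ?g v" for v by (simp add: tail_def)
    show "?g v \<le> v" if "0 < v" for v
    proof -
      have "tail_inv v \<le> l * tail_inv v" using tail_inv_pos[OF that] l by simp
      from tail_ratio_bounds(2)[OF that this] show ?thesis using that by simp
    qed
    have "measure (M t) {\<omega> \<in> space (M t). l * X t (Suc k) \<omega> < X t r \<omega>} =
        (\<integral>v. binomial_tail k r (?g (v * inverse t) / (v * inverse t)) \<partial>erlang k)" if "0 < t" for t
    proof -
      interpret opp: ordered_poisson_points "M t" "scale_measure (ennreal t) \<mu>" "X t"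
        using tail_measure_scale[OF that] M[OF that] X[OF that]
        by (simp add: ordered_poisson_points_def ordered_poisson_points_axioms_def)
      show ?thesis
        using opp.prob_ratio[OF r l] that
        by (simp add: tail_scale_measure tail_inv_scale divide_inverse mult_ac)
    qed
    then have "\<forall>\<^sub>F t in at_right 0. measure (M t) {\<omega> \<in> space (M t). l * X t (Suc k) \<omega> < X t r \<omega>} =
        (\<integral>v. binomial_tail k r (?g (v * inverse t) / (v * inverse t)) \<partial>erlang k)"
      using eventually_at_right_less[of "0::real"] by (auto elim: eventually_mono)
    then have "((\<lambda>t. \<integral>v. binomial_tail k r (?g (v * inverse t) / (v * inverse t)) \<partial>erlang k) \<longlongrightarrow> G) (at_right 0)"
      by (rule Lim_transform_eventually[OF lim])
    then show "((\<lambda>x. \<integral>v. binomial_tail k r (?g (v * x) / (v * x)) \<partial>erlang k) \<longlongrightarrow> G) at_top"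
      unfolding filterlim_at_right_to_top by simp
  qed
qed (use l p in auto)

theorem theorem5p1:
  fixes \<nu> :: "real measure"
    and M :: "real \<Rightarrow> 'a measure"
    and \<Delta> :: "real \<Rightarrow> nat \<Rightarrow> 'a \<Rightarrow> real"
    and N :: "'b measure"
    and Y :: "'b \<Rightarrow> ereal"
    and r n :: nat
  assumes "sets \<nu> = sets (restrict_space borel {0<..})"
    and "\<And>x. x > 0 \<Longrightarrow> 0 < emeasure \<nu> {x<..} \<and> emeasure \<nu> {x<..} < \<infinity>"
    and "emeasure \<nu> {0<..} = \<infinity>"
    and "\<And>t. t > 0 \<Longrightarrow> prob_space (M t)"
    and "\<And>t. t > 0 \<Longrightarrow> ordered_ppp (M t) (\<Delta> t) (scale_measure (ennreal t) \<nu>)"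
    and "r \<ge> 1" and "n \<ge> 1"
    and "prob_space N"
    and "Y \<in> borel_measurable N"
    and "AE \<omega> in N. Y \<omega> \<ge> 1"
    and "converges_in_distribution_on {1..\<infinity>} M
           (\<lambda>t \<omega>. ereal (\<Delta> t r \<omega> / \<Delta> t (r + n) \<omega>)) N Y (at_right 0)"
  shows "(measure N {\<omega> \<in> space N. 1 < Y \<omega> \<and> Y \<omega> < \<infinity>} > 0 \<and>
            (\<exists>\<alpha>>0. regularly_varying_at_0 (tail \<nu>) (- \<alpha>))) \<or>
         (measure N {\<omega> \<in> space N. Y \<omega> = 1} = 1 \<and> rapidly_varying_at_0 (tail \<nu>)) \<or>
         ((AE \<omega> in N. Y \<omega> = \<infinity>) \<and> slowly_varying_at_0 (tail \<nu>))"
proof -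
  interpret tail_measure \<nu> by unfold_locales (use assms in auto)
  interpret f: positive_antimono "tail \<nu>" by unfold_locales (use tail_pos tail_antimono in auto)
  interpret N: prob_space N by fact
  note [measurable] = assms(9)
  define k where "k = r + n - 1"
  have k: "r + n = Suc k" "r \<le> k" using assms(7) by (auto simp: k_def)
  define D where "D = {l. 1 < l \<and> N.prob {\<omega> \<in> space N. Y \<omega> = ereal l} = 0}"
  define G where "G l = N.prob {\<omega> \<in> space N. ereal l < Y \<omega>}" for l
  have cnt: "countable ({1<..} - D)"
    by (rule countable_subset[OF _ countable_atoms[OF assms(8,9)]]) (auto simp: D_def)
  have D: "D \<subseteq> {1<..}" by (auto simp: D_def)
  have dense: "\<exists>l\<in>D. a < l \<and> l < b" if "1 \<le> a" "a < b" for a b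
  proof -
    have "uncountable {a<..<b}" using that by (simp add: uncountable_open_interval)
    then obtain l where "l \<in> {a<..<b}" "l \<notin> {1<..} - D" using cnt by (meson countable_subset subsetI)
    then show ?thesis using that by (intro bexI[of _ l]) auto
  qed
  have tail_prob: "((\<lambda>t. measure (M t) {\<omega> \<in> space (M t). l * \<Delta> t (Suc k) \<omega> < \<Delta> t r \<omega>}) \<longlongrightarrow> G l) (at_right 0)"
    if "l \<in> D" for l
  proof -
    have pos: "\<forall>\<^sub>F t in at_right (0::real). 0 < t" by (rule eventually_at_right_less)
    have meas: "\<Delta> t i \<in> borel_measurable (M t)" if "0 < t" "1 \<le> i" for t i
      using assms(5)[OF that(1)] that(2) by (simp add: ordered_ppp_def)
    have "\<forall>\<^sub>F t in at_right 0. prob_space (M t) \<and> (\<lambda>\<omega>. ereal (\<Delta> t r \<omega> / \<Delta> t (r + n) \<omega>)) \<in> borel_measurable (M t)"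
      using pos
    proof eventually_elim
      case (elim t)
      have [measurable]: "\<Delta> t r \<in> borel_measurable (M t)" "\<Delta> t (r + n) \<in> borel_measurable (M t)"
        using meas[OF elim] assms(6) by auto
      show ?case using assms(4)[OF elim] by simp
    qed
    from converges_in_distribution_on_tail_prob[OF assms(11) this assms(8,9), of l]
    have "((\<lambda>t. measure (M t) {\<omega> \<in> space (M t). ereal l < ereal (\<Delta> t r \<omega> / \<Delta> t (r + n) \<omega>)}) \<longlongrightarrow> G l) (at_right 0)"
      using that by (simp add: D_def G_def)
    moreover have "\<forall>\<^sub>F t in at_right 0. measure (M t) {\<omega> \<in> space (M t). ereal l < ereal (\<Delta> t r \<omega> / \<Delta> t (r + n) \<omega>)} =
        measure (M t) {\<omega> \<in> space (M t). l * \<Delta> t (Suc k) \<omega> < \<Delta> t r \<omega>}"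
      using pos
    proof eventually_elim
      case (elim t)
      have [measurable]: "\<Delta> t r \<in> borel_measurable (M t)" "\<Delta> t (Suc k) \<in> borel_measurable (M t)"
        using meas[OF elim] assms(6) by auto
      interpret opp: ordered_poisson_points "M t" "scale_measure (ennreal t) \<nu>" "\<Delta> t"
        using tail_measure_scale[OF elim] assms(4,5)[OF elim]
        by (simp add: ordered_poisson_points_def ordered_poisson_points_axioms_def)
      show ?case unfolding k(1)
      proof (rule opp.finite_measure_eq_AE)
        have "1 \<le> Suc k" by simp
        from opp.AE_X_pos[OF this]
        show "AE \<omega> in M t. \<omega> \<in> {\<omega> \<in> space (M t). ereal l < ereal (\<Delta> t r \<omega> / \<Delta> t (Suc k) \<omega>)} \<longleftrightarrow>
            \<omega> \<in> {\<omega> \<in> space (M t). l * \<Delta> t (Suc k) \<omega> < \<Delta> t r \<omega>}"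
          by eventually_elim (simp add: pos_less_divide_eq)
      qed measurable
    qed
    ultimately show ?thesis by (rule Lim_transform_eventually)
  qed
  have "\<exists>p. 0 \<le> p \<and> p \<le> 1 \<and> binomial_tail k r p = G l" for l
    using binomial_tail_surj[OF assms(6) k(2), of "G l"] by (auto simp: G_def)
  then obtain p where p: "\<And>l. 0 \<le> p l" "\<And>l. p l \<le> 1" "\<And>l. binomial_tail k r (p l) = G l" by metis
  have lim: "ratio_limit (tail \<nu>) l (p l)" if "l \<in> D" for l
    using ratio_limit_of_tail_prob[OF assms(4,5) assms(6) k(2) _ tail_prob[OF that] p] D that by auto
  show ?thesis
  proof (cases "\<forall>l\<in>D. 0 < p l")
    case True
    obtain \<alpha> where \<alpha>: "0 \<le> \<alpha>" "regularly_varying_at_0 (tail \<nu>) (- \<alpha>)"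
      using f.regularly_varying_if_ratio_limits[OF cnt D lim] True by blast
    have p_eq: "p l = l powr (- \<alpha>)" if "l \<in> D" for l
      using \<alpha>(2) ratio_limit_unique[OF lim[OF that]] D that
      by (force simp: regularly_varying_at_0_def ratio_limit_def)
    show ?thesis
    proof (cases "\<alpha> = 0")
      case True
      have AE: "AE \<omega> in N. ereal l < Y \<omega>" if "l \<in> D" for l
      proof -
        have "G l = 1" using p(3)[of l] p_eq[OF that] True D that k(2) by (auto simp: binomial_tail_1)
        then show ?thesis unfolding G_def by (subst (asm) N.prob_Collect_eq_1) auto
      qed
      have "AE \<omega> in N. ereal (real i) < Y \<omega>" for i
      proof -
        obtain l where l: "l \<in> D" "real i + 1 < l" using dense[of "real i + 1" "real i + 2"] by auto
        then have "ereal (real i) < ereal l" by simp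
        then show ?thesis by (intro eventually_mono[OF AE[OF l(1)]]) (rule less_trans)
      qed
      then have "AE \<omega> in N. \<forall>i. ereal (real i) < Y \<omega>" by (simp add: AE_all_countable)
      then have "AE \<omega> in N. Y \<omega> = \<infinity>"
      proof eventually_elim
        case (elim \<omega>)
        show ?case
        proof (cases "Y \<omega>")
          case (real y)
          then show ?thesis using elim real_arch_simple[of y] by (metis ereal_less_eq(3) leD)
        qed (use elim in auto)
      qed
      then show ?thesis using \<alpha>(2) True by (simp add: slowly_varying_at_0_def)
    next
      case False
      with \<alpha> have "0 < \<alpha>" by simp
      obtain l1 where l1: "l1 \<in> D" "1 < l1" "l1 < 2" using dense[of 1 2] by auto
      obtain l2 where l2: "l2 \<in> D" "2 < l2" using dense[of 2 3] by auto
      have "p l2 < p l1"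
        using l1 l2 \<open>0 < \<alpha>\<close> by (simp add: p_eq powr_less_mono2_neg)
      then have "G l2 < G l1"
        using binomial_tail_strict_mono[OF assms(6) k(2) p(1) _ p(2), of l2 l1] by (simp add: p(3))
      moreover have "G l1 \<le> G l2 + N.prob {\<omega> \<in> space N. 1 < Y \<omega> \<and> Y \<omega> < \<infinity>}"
      proof -
        have "G l1 \<le> N.prob ({\<omega> \<in> space N. ereal l2 < Y \<omega>} \<union> {\<omega> \<in> space N. 1 < Y \<omega> \<and> Y \<omega> < \<infinity>})"
          unfolding G_def
        proof (rule N.finite_measure_mono)
          show "{\<omega> \<in> space N. ereal l1 < Y \<omega>} \<subseteq>
              {\<omega> \<in> space N. ereal l2 < Y \<omega>} \<union> {\<omega> \<in> space N. 1 < Y \<omega> \<and> Y \<omega> < \<infinity>}"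
          proof
            fix \<omega> assume "\<omega> \<in> {\<omega> \<in> space N. ereal l1 < Y \<omega>}"
            then show "\<omega> \<in> {\<omega> \<in> space N. ereal l2 < Y \<omega>} \<union> {\<omega> \<in> space N. 1 < Y \<omega> \<and> Y \<omega> < \<infinity>}"
              using l1 by (cases "Y \<omega>") (auto simp: one_ereal_def)
          qed
        qed measurable
        also have "\<dots> \<le> G l2 + N.prob {\<omega> \<in> space N. 1 < Y \<omega> \<and> Y \<omega> < \<infinity>}"
          unfolding G_def by (rule measure_Un_le) measurable
        finally show ?thesis .
      qed
      ultimately show ?thesis using \<alpha>(2) \<open>0 < \<alpha>\<close> by auto
    qed
  next
    case False
    then obtain l0 where l0: "l0 \<in> D" "p l0 = 0" using p(1) by (metis less_eq_real_def)
    \<comment> \<open>some power of \<open>l\<close> exceeds \<open>l0\<close>, and its ratio limit is the power of \<open>p l\<close>\<close>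
    have p0: "p l = 0" if "l \<in> D" for l
    proof -
      have l: "1 < l" using D that by auto
      obtain i where i: "l0 < l ^ i" using real_arch_pow[OF l] by blast
      have "p l ^ i \<le> p l0"
        using f.ratio_limit_antimono[OF lim[OF l0(1)] f.ratio_limit_power[OF lim[OF that]]] l i D l0 by auto
      then have "p l ^ i = 0" using l0(2) zero_le_power[OF p(1), of l i] by linarith
      then show ?thesis by simp
    qed
    have "rapidly_varying_at_0 (tail \<nu>)"
    proof (rule f.rapidly_varying_if_ratio_limits_0)
      fix c :: real assume "1 < c"
      then obtain l where "l \<in> D" "1 < l" "l < c" using dense[of 1 c] by auto
      then show "\<exists>l>1. l < c \<and> ratio_limit (tail \<nu>) l 0" using lim p0 by metis
    qed
    moreover have "N.prob {\<omega> \<in> space N. Y \<omega> = 1} = 1"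
    proof -
      have AE: "AE \<omega> in N. Y \<omega> \<le> ereal l" if "l \<in> D" for l
      proof -
        have "G l = 0" using p(3)[of l] p0[OF that] assms(6) by (simp add: binomial_tail_0)
        then have "AE \<omega> in N. \<not> ereal l < Y \<omega>" unfolding G_def by (subst (asm) N.prob_Collect_eq_0) auto
        then show ?thesis by (simp add: not_less)
      qed
      have "AE \<omega> in N. Y \<omega> \<le> ereal (1 + 1 / real (Suc i))" for i
      proof -
        obtain l where l: "l \<in> D" "l < 1 + 1 / real (Suc i)" using dense[of 1 "1 + 1 / real (Suc i)"] by auto
        then have "ereal l \<le> ereal (1 + 1 / real (Suc i))" by simp
        then show ?thesis using AE[OF l(1)] by (auto elim!: eventually_mono intro: order_trans)
      qed
      then have "AE \<omega> in N. \<forall>i. Y \<omega> \<le> ereal (1 + 1 / real (Suc i))" by (simp add: AE_all_countable)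
      then have "AE \<omega> in N. Y \<omega> = 1"
        using assms(10)
      proof eventually_elim
        case (elim \<omega>)
        have "(\<lambda>i. ereal (1 + 1 / real (Suc i))) \<longlonglongrightarrow> ereal (1 + 0)"
          by (intro tendsto_intros LIMSEQ_Suc lim_1_over_n)
        then have "Y \<omega> \<le> ereal (1 + 0)"
          by (rule LIMSEQ_le_const) (use elim(1) in blast)
        then show ?case using elim(2) by (simp add: one_ereal_def)
      qed
      then show ?thesis by (subst N.prob_Collect_eq_1) auto
    qed
    ultimately show ?thesis by blast
  qed
qed

end
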